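(* There is an absolute constant $K<\infty$ such that, for every pair of positive integers $m,n$ with $m\le n$ and every function $f:\{-1,1\}^n\to\mathbb{C}$ of degree at most $m$, $$\left(\sum_{|S|\le m}|\widehat f(S)|^{2m/(m+1)}\right)^{(m+1)/(2m)}\le K\,m^{27}\,\|f\|_\infty,$$ where the sum is over all subsets $S\subseteq[n]$ with $|S|\le m$. Equivalently, $\mathsf{B}_m\le K m^{27}$ for every $m\ge 1$.
   Context: Let $[n]=\{1,\dots,n\}$ and equip $\{-1,1\}^n$ with its uniform probability measure, with expectation $\mathbb{E}$. Every $f:\{-1,1\}^n\to\mathbb{C}$ has the Fourier--Walsh expansion $f(x)=\sum_{S\subseteq[n]}\widehat f(S)x^S$, where $x^S=\prod_{j\in S}x_j$ and $\widehat f(S)=\mathbb{E}[f(x)x^S]$. The function $f$ has degree at most $m$ if $\widehat f(S)=0$ whenever $|S|>m$. $\|f\|_\infty=\max_{x\in\{-1,1\}^n}|f(x)|$. $\mathsf{B}_m$ denotes the least constant, independent of the dimension $n$, such that $\left(\sum_{|S|\le m}|\widehat f(S)|^{2m/(m+1)}\right)^{(m+1)/(2m)}\le \mathsf{B}_m\|f\|_\infty$ for all $n$ and all $f:\{-1,1\}^n\to\mathbb{C}$ of degree at most $m$. *)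

theory Defs
  imports "HOL-Probability.Probability"
begin

(* Points of the cube are functions on {1..n}, extended by undefined elsewhere, so that the cube is
   a finite set of cardinality 2 ^ n. Only the values of f on the cube are ever used. *)
definition cube :: "nat \<Rightarrow> (nat \<Rightarrow> real) set" where
  "cube n = {1..n} \<rightarrow>\<^sub>E {-1, 1}"

definition walsh :: "nat set \<Rightarrow> (nat \<Rightarrow> real) \<Rightarrow> real" where
  "walsh S x = (\<Prod>j\<in>S. x j)"

definition fourier_coeff :: "nat \<Rightarrow> ((nat \<Rightarrow> real) \<Rightarrow> complex) \<Rightarrow> nat set \<Rightarrow> complex" where
  "fourier_coeff n f S =
     measure_pmf.expectation (pmf_of_set (cube n)) (\<lambda>x. f x * complex_of_real (walsh S x))"

definition degree_at_most :: "nat \<Rightarrow> nat \<Rightarrow> ((nat \<Rightarrow> real) \<Rightarrow> complex) \<Rightarrow> bool" where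
  "degree_at_most n m f \<longleftrightarrow> (\<forall>S. S \<subseteq> {1..n} \<and> card S > m \<longrightarrow> fourier_coeff n f S = 0)"

definition cube_sup_norm :: "nat \<Rightarrow> ((nat \<Rightarrow> real) \<Rightarrow> complex) \<Rightarrow> real" where
  "cube_sup_norm n f = Max ((\<lambda>x. cmod (f x)) ` cube n)"

definition bh_norm :: "nat \<Rightarrow> nat \<Rightarrow> ((nat \<Rightarrow> real) \<Rightarrow> complex) \<Rightarrow> real" where
  "bh_norm n m f =
     (\<Sum>S | S \<subseteq> {1..n} \<and> card S \<le> m.
        cmod (fourier_coeff n f S) powr (2 * real m / (real m + 1)))
     powr ((real m + 1) / (2 * real m))"

(* The least admissible constant. The set of admissible constants is closed and bounded below, so
   the infimum is attained whenever the set is nonempty; the infimum is taken in ereal so that it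
   is infinite, rather than an unspecified real, if there is no admissible constant. *)
definition bh_const :: "nat \<Rightarrow> ereal" where
  "bh_const m =
     Inf {ereal C | C. \<forall>n f. degree_at_most n m f \<longrightarrow> bh_norm n m f \<le> C * cube_sup_norm n f}"

end

theory Submission
  imports Defs
begin

text \<open>
  Write $p_a = 2a/(a+1)$ and let $f_a$ be the part of $f$ of degree exactly $a$, with vector of
  coefficients $\hat f_a$. For real $f$ of degree at most $M$ with $|f| \le 1$, the proof bounds
  $\sum_{a \le N} \|\hat f_a\|_{p_a}^2$ by a power of $M$ times a power of $N$, through a recursion that
  passes from $3N/4$ to $N$ and costs a constant. A constant cost at each of the $\log N$ scales is
  polynomial in $N$.

  Split the variables into two blocks $A$ and $B$ and freeze those in $B$ at $y$. The bound for levels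
  at most $N$ applies to $f(\cdot, y)$, whose coefficients $g_S(y)$, $S \subseteq A$, are themselves
  polynomials on the cube over $B$. After averaging over $y$ one holds the $L_{p_a}$ norms of $g_S$
  for $|S| = a$. Hypercontractivity (\<open>Bonami_Beckner\<close>) bounds them from below by $\ell_2$ norms in
  which a coefficient of level $b$ in $B$ is damped by $(p_a - 1)^{b/2}$. Since
  $p_a - 1 = (a-1)/(a+1)$, this factor is bounded below when $a \ge 2$ and $b$ is at most a constant
  multiple of $a$.
  This is the point of the argument: the function $f(\cdot, y)$ may keep its full degree $M$.
  On the cube, projecting a bounded function onto one of its degrees can cost a factor exponential in
  that degree; the damping replaces such projections at a bounded price.

  The outcome is a bound for mixed norms $\ell_{p_a}(\ell_2)$, with $A$ outside, and by symmetry one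
  for $\ell_{p_b}(\ell_2)$, with $B$ outside (\<open>weighted_mixed_norm_bound\<close>). Blei's interpolation
  (\<open>Blei_interpolation\<close>) turns the two into a bound for $\ell_{p_{a+b}}$, with exactly the right
  exponent. Because squares are summed over all levels, all pairs $(a, b)$ are controlled
  simultaneously, and averaging over the block $A$ recovers level $m$ up to the probability that a
  set of size $m$ is split into balanced parts (\<open>level_norm_sum_step\<close>). By Chebyshev's inequality
  this probability is at least $1/5$ for $m \ge 5$.

  The recursion cannot start at level 1, because $p_1 - 1 = 0$. The first four levels are treated
  directly: the part of $f$ of degree $k$ is the coefficient of $\rho^k$ in the polynomial $f(\rho x)$,
  so it is bounded by a multiple of $M^{2k}$ (\<open>cube_bounded_level_part\<close>), and on functions of degree
  at most 4 all moments are comparable, so that the same splitting argument gives some constant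
  (\<open>level_bound_degree_four\<close>).

  In total the first levels contribute $M^8$, the recursion $M^{12}$, and adding the levels one more
  factor $M$, which gives the exponent 21; for $m \ge 1$ this is at most $m^{27}$.
\<close>

section \<open>Hoelder, Minkowski and Blei inequalities for finite sums\<close>

text \<open>
  Concavity of the weighted geometric mean: after dividing $f$ and $g$ by their sums, Young's
  inequality bounds every summand by a convex combination that sums to 1.
\<close>
lemma Hoelder_sum:
  fixes f g :: "'a \<Rightarrow> real"
  assumes ab: "0 < \<alpha>" "0 < \<beta>" "\<alpha> + \<beta> = 1"
    and f: "\<And>i. i \<in> I \<Longrightarrow> 0 \<le> f i" and g: "\<And>i. i \<in> I \<Longrightarrow> 0 \<le> g i"
  shows "(\<Sum>i\<in>I. f i powr \<alpha> * g i powr \<beta>) \<le> (\<Sum>i\<in>I. f i) powr \<alpha> * (\<Sum>i\<in>I. g i) powr \<beta>"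
proof (cases "finite I \<and> sum f I > 0 \<and> sum g I > 0")
  case False
  have zero: "f i powr \<alpha> * g i powr \<beta> = 0" if fin: "finite I" and i: "i \<in> I" for i
  proof -
    have "sum f I = 0 \<or> sum g I = 0"
      using False fin sum_nonneg[of I f] sum_nonneg[of I g] f g by fastforce
    then show ?thesis
      using fin i f g sum_nonneg_eq_0_iff[of I f] sum_nonneg_eq_0_iff[of I g] by auto
  qed
  have "(\<Sum>i\<in>I. f i powr \<alpha> * g i powr \<beta>) = 0"
  proof (cases "finite I")
    case True
    then show ?thesis using zero by (intro sum.neutral) blast
  qed simp
  then show ?thesis by simp
next
  case True
  define F where "F = sum f I"
  define G where "G = sum g I"
  have FG: "F > 0" "G > 0" using True by (auto simp: F_def G_def)
  have y: "a powr \<alpha> * b powr \<beta> \<le> \<alpha> * a + \<beta> * b" if "a \<ge> 0" "b \<ge> 0" for a b :: real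
    using Youngs_inequality_0[of \<alpha> \<beta> a b] ab that by (cases "a = 0 \<or> b = 0") auto
  have "(\<Sum>i\<in>I. (f i / F) powr \<alpha> * (g i / G) powr \<beta>) \<le> (\<Sum>i\<in>I. \<alpha> * (f i / F) + \<beta> * (g i / G))"
    using f g FG by (intro sum_mono y) auto
  also have "\<dots> = \<alpha> * (F / F) + \<beta> * (G / G)"
    by (simp only: sum.distrib F_def G_def sum_distrib_left sum_divide_distrib)
  also have "\<dots> = 1" using FG ab by simp
  finally have "(\<Sum>i\<in>I. (f i powr \<alpha> * g i powr \<beta>) / (F powr \<alpha> * G powr \<beta>)) \<le> 1"
    using f g FG by (simp add: powr_divide field_simps)
  then have "(\<Sum>i\<in>I. (f i powr \<alpha> * g i powr \<beta>)) / (F powr \<alpha> * G powr \<beta>) \<le> 1"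
    by (simp add: sum_divide_distrib)
  then show ?thesis using FG by (simp add: divide_le_eq F_def G_def)
qed

lemma powr_mean_le_mean_powr:
  fixes h :: "'a \<Rightarrow> real"
  assumes r: "1 \<le> r" and h: "\<And>i. i \<in> I \<Longrightarrow> 0 \<le> h i" and I: "finite I" "I \<noteq> {}"
  shows "((\<Sum>i\<in>I. h i) / card I) powr r \<le> (\<Sum>i\<in>I. h i powr r) / card I"
proof (cases "r = 1")
  case True
  have "(\<Sum>i\<in>I. h i powr r) = sum h I" using True h by simp
  moreover have "0 \<le> (\<Sum>i\<in>I. h i) / card I" using h by (simp add: sum_nonneg)
  ultimately show ?thesis using True by simp
next
  case False
  then have r1: "r > 1" using r by simp
  have n: "real (card I) > 0" using I by (simp add: card_gt_0_iff)
  have "sum h I = (\<Sum>i\<in>I. (h i powr r) powr (1/r) * 1 powr (1 - 1/r))"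
    using r1 h by (intro sum.cong) (auto simp: powr_powr)
  also have "\<dots> \<le> (\<Sum>i\<in>I. h i powr r) powr (1/r) * (\<Sum>i\<in>I. 1) powr (1 - 1/r)"
    using r1 by (intro Hoelder_sum) auto
  finally have "sum h I powr r \<le> ((\<Sum>i\<in>I. h i powr r) powr (1/r) * card I powr (1 - 1/r)) powr r"
    using h r by (intro powr_mono2) (auto intro: sum_nonneg)
  also have "\<dots> = (\<Sum>i\<in>I. h i powr r) * card I powr (r - 1)"
  proof -
    have "(1 - 1/r) * r = r - 1" using r1 by (simp add: field_simps)
    then show ?thesis using r1 n by (simp add: powr_mult powr_powr sum_nonneg)
  qed
  finally show ?thesis
    using n h by (simp add: powr_divide sum_nonneg powr_diff field_simps)
qed

text \<open>
  The triangle inequality of $\ell_r$, from Hoelder: write $Z_j^r = \sum_i Y_{ij} Z_j^{r-1}$ with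
  $Z_j = \sum_i Y_{ij}$ and cancel a power of $\sum_j Z_j^r$. Besides the triangle inequality itself,
  it serves to exchange the order of mixed norms $\ell_p(\ell_2)$.
\<close>
lemma Minkowski_sum:
  fixes Y :: "'a \<Rightarrow> 'b \<Rightarrow> real"
  assumes r: "1 \<le> r" and Y: "\<And>i j. i \<in> I \<Longrightarrow> j \<in> J \<Longrightarrow> 0 \<le> Y i j"
  shows "(\<Sum>j\<in>J. (\<Sum>i\<in>I. Y i j) powr r) powr (1/r) \<le> (\<Sum>i\<in>I. (\<Sum>j\<in>J. Y i j powr r) powr (1/r))"
proof (cases "r = 1")
  case True
  have "(\<Sum>j\<in>J. (\<Sum>i\<in>I. Y i j) powr r) powr (1/r) = (\<Sum>j\<in>J. \<Sum>i\<in>I. Y i j)"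
    using True Y by (simp add: sum_nonneg)
  also have "\<dots> = (\<Sum>i\<in>I. \<Sum>j\<in>J. Y i j)" by (rule sum.swap)
  also have "\<dots> = (\<Sum>i\<in>I. (\<Sum>j\<in>J. Y i j powr r) powr (1/r))"
    using True Y by (simp add: sum_nonneg)
  finally show ?thesis by simp
next
  case False
  then have r1: "r > 1" using r by simp
  define Z where "Z j = (\<Sum>i\<in>I. Y i j)" for j
  define T where "T = (\<Sum>j\<in>J. Z j powr r)"
  have Z0: "0 \<le> Z j" if "j \<in> J" for j using that Y by (auto simp: Z_def intro: sum_nonneg)
  have T0: "0 \<le> T" by (auto simp: T_def intro: sum_nonneg)
  have Zr: "Z j powr r = Z j * Z j powr (r - 1)" if "j \<in> J" for j
    using Z0[OF that] r1 by (cases "Z j = 0") (auto simp: powr_diff)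
  have "T = (\<Sum>j\<in>J. \<Sum>i\<in>I. Y i j * Z j powr (r - 1))"
    unfolding T_def by (intro sum.cong refl) (simp add: Zr, simp add: Z_def sum_distrib_right)
  also have "\<dots> = (\<Sum>i\<in>I. \<Sum>j\<in>J. Y i j * Z j powr (r - 1))" by (rule sum.swap)
  also have "\<dots> = (\<Sum>i\<in>I. \<Sum>j\<in>J. (Y i j powr r) powr (1/r) * (Z j powr r) powr (1 - 1/r))"
  proof -
    have "r * (1 - 1/r) = r - 1" using r1 by (simp add: field_simps)
    then show ?thesis using r1 Y by (intro sum.cong refl) (simp add: powr_powr)
  qed
  also have "\<dots> \<le> (\<Sum>i\<in>I. (\<Sum>j\<in>J. Y i j powr r) powr (1/r) * (\<Sum>j\<in>J. Z j powr r) powr (1 - 1/r))"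
    using r1 by (intro sum_mono Hoelder_sum) auto
  also have "\<dots> = (\<Sum>i\<in>I. (\<Sum>j\<in>J. Y i j powr r) powr (1/r)) * T powr (1 - 1/r)"
    by (simp add: sum_distrib_right T_def)
  finally have *: "T \<le> (\<Sum>i\<in>I. (\<Sum>j\<in>J. Y i j powr r) powr (1/r)) * T powr (1 - 1/r)" .
  have "T powr (1/r) \<le> (\<Sum>i\<in>I. (\<Sum>j\<in>J. Y i j powr r) powr (1/r))"
  proof (cases "T = 0")
    case True then show ?thesis by (auto intro: sum_nonneg)
  next
    case False
    then have T: "T > 0" using T0 by simp
    then have "T = T powr (1/r) * T powr (1 - 1/r)" by (simp flip: powr_add)
    then have "T powr (1/r) * T powr (1 - 1/r)
        \<le> (\<Sum>i\<in>I. (\<Sum>j\<in>J. Y i j powr r) powr (1/r)) * T powr (1 - 1/r)"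
      using * by linarith
    then show ?thesis by (rule mult_right_le_imp_le) (use T in simp)
  qed
  then show ?thesis by (simp add: T_def Z_def)
qed

text \<open>
  The step in which the exponents of two degrees combine. With $z = x^2$ and $p_a = 2a/(a+1)$, the
  quantities \<open>Ga\<close> and \<open>Gb\<close> are the squares of the mixed norms $\ell_{p_a}(\ell_2)$ and
  $\ell_{p_b}(\ell_2)$, each with its own index outside. Since
  $1/p_{a+b} = \theta/p_a + (1-\theta)/2 = \theta/2 + (1-\theta)/p_b$ for $\theta = a/(a+b)$, the norm of
  $\ell_{p_{a+b}}$ over both indices lies between them. Hoelder is applied first in $j$ and then in
  $i$; Minkowski brings the second mixed norm into the order in which Hoelder produces it.
\<close>
lemma Blei_interpolation:
  fixes z :: "'a \<Rightarrow> 'b \<Rightarrow> real" and a b :: real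
  assumes ab: "0 < a" "0 < b" and z: "\<And>i j. i \<in> I \<Longrightarrow> j \<in> J \<Longrightarrow> 0 \<le> z i j"
  defines "Ga \<equiv> (\<Sum>i\<in>I. (\<Sum>j\<in>J. z i j) powr (a / (a + 1))) powr (1 + 1 / a)"
  defines "Gb \<equiv> (\<Sum>j\<in>J. (\<Sum>i\<in>I. z i j) powr (b / (b + 1))) powr (1 + 1 / b)"
  shows "(\<Sum>i\<in>I. \<Sum>j\<in>J. z i j powr ((a + b) / (a + b + 1))) powr (1 + 1 / (a + b))
         \<le> Ga powr (a / (a + b)) * Gb powr (b / (a + b))"
proof -
  let ?m = "a + b"
  have nz: "a \<noteq> 0" "b \<noteq> 0" "a + 1 \<noteq> 0" "b + 1 \<noteq> 0" "a + b + 1 \<noteq> 0" "a + b \<noteq> 0"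
    "?m + 1 > 0" "a + 1 > 0" "b + 1 > 0" "?m > 0" "1 + b \<noteq> 0" "1 + (a + b) \<noteq> 0" using ab by auto
  define R where "R i = (\<Sum>j\<in>J. z i j)" for i
  define C where "C i = (\<Sum>j\<in>J. z i j powr (b / (b + 1)))" for i
  have cancel: "x / y * (y / w) = x / w" if "y \<noteq> 0" for x y w :: real
    using that by simp
  have e1: "b / (b + 1) * ((b + 1) / (?m + 1)) = b / (?m + 1)"
    by (rule cancel) (fact nz)
  have inner: "(\<Sum>j\<in>J. z i j powr (?m / (?m + 1))) \<le> R i powr (a / (?m + 1)) * C i powr ((b + 1) / (?m + 1))"
    if i: "i \<in> I" for i
  proof -
    have "?m / (?m + 1) = a / (?m + 1) + b / (b + 1) * ((b + 1) / (?m + 1))"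
      unfolding e1 by (simp add: add_divide_distrib)
    then have "z i j powr (?m / (?m + 1)) = z i j powr (a / (?m + 1)) * (z i j powr (b / (b + 1))) powr ((b + 1) / (?m + 1))"
      for j unfolding powr_powr powr_add[symmetric] by (rule arg_cong)
    then have "(\<Sum>j\<in>J. z i j powr (?m / (?m + 1)))
        = (\<Sum>j\<in>J. z i j powr (a / (?m + 1)) * (z i j powr (b / (b + 1))) powr ((b + 1) / (?m + 1)))"
      by simp
    also have "\<dots> \<le> R i powr (a / (?m + 1)) * C i powr ((b + 1) / (?m + 1))"
      unfolding R_def C_def using z[OF i] ab nz
      by (intro Hoelder_sum) (auto simp: add_divide_distrib [symmetric])
    finally show ?thesis .
  qed
  have e2: "a / (a + 1) * ((a + 1) / (?m + 1)) = a / (?m + 1)" by (rule cancel) (fact nz)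
  have e3: "(1 + 1 / b) * (b / (?m + 1)) = (b + 1) / (?m + 1)"
  proof -
    have "1 + 1 / b = (b + 1) / b" using nz by (simp add: add_divide_distrib)
    then show ?thesis using cancel[of b "b + 1" "?m + 1"] nz by simp
  qed
  have "(\<Sum>i\<in>I. \<Sum>j\<in>J. z i j powr (?m / (?m + 1)))
      \<le> (\<Sum>i\<in>I. R i powr (a / (?m + 1)) * C i powr ((b + 1) / (?m + 1)))"
    by (intro sum_mono inner)
  also have "\<dots> = (\<Sum>i\<in>I. (R i powr (a / (a + 1))) powr ((a + 1) / (?m + 1)) *
       (C i powr (1 + 1 / b)) powr (b / (?m + 1)))"
    unfolding powr_powr e2 e3 ..
  also have "\<dots> \<le> (\<Sum>i\<in>I. R i powr (a / (a + 1))) powr ((a + 1) / (?m + 1)) *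
       (\<Sum>i\<in>I. C i powr (1 + 1 / b)) powr (b / (?m + 1))"
    using ab nz by (intro Hoelder_sum) (auto simp: add_divide_distrib [symmetric])
  also have "\<dots> \<le> Ga powr (a / (?m + 1)) * Gb powr (b / (?m + 1))"
  proof (intro mult_mono)
    have e4: "(1 + 1 / a) * (a / (?m + 1)) = (a + 1) / (?m + 1)"
    proof -
      have "1 + 1 / a = (a + 1) / a" using nz by (simp add: add_divide_distrib)
      then show ?thesis using cancel[of a "a + 1" "?m + 1"] nz by simp
    qed
    show "(\<Sum>i\<in>I. R i powr (a / (a + 1))) powr ((a + 1) / (?m + 1)) \<le> Ga powr (a / (?m + 1))"
      unfolding Ga_def powr_powr e4 by (simp add: R_def)
    have e5: "1 / (1 + 1 / b) = b / (b + 1)" using nz by (simp add: field_simps)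
    have e6: "b / (b + 1) * (1 + 1 / b) = 1"
    proof -
      have "1 + 1 / b = (b + 1) / b" using nz by (simp add: add_divide_distrib)
      then show ?thesis using cancel[of "b + 1" b b] nz by simp
    qed
    have "(\<Sum>i\<in>I. (\<Sum>j\<in>J. z i j powr (b / (b + 1))) powr (1 + 1 / b)) powr (1 / (1 + 1 / b))
        \<le> (\<Sum>j\<in>J. (\<Sum>i\<in>I. (z i j powr (b / (b + 1))) powr (1 + 1 / b)) powr (1 / (1 + 1 / b)))"
      using ab by (intro Minkowski_sum) auto
    also have "\<dots> = (\<Sum>j\<in>J. (\<Sum>i\<in>I. z i j) powr (b / (b + 1)))"
      unfolding powr_powr e5 e6 using z by simp
    finally have "((\<Sum>i\<in>I. C i powr (1 + 1 / b)) powr (b / (b + 1))) powr (1 + 1 / b) \<le> Gb"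
      unfolding Gb_def e5 C_def[symmetric] using ab by (intro powr_mono2) auto
    then have "(\<Sum>i\<in>I. C i powr (1 + 1 / b)) \<le> Gb"
      unfolding powr_powr e6 by (simp add: sum_nonneg)
    then show "(\<Sum>i\<in>I. C i powr (1 + 1 / b)) powr (b / (?m + 1)) \<le> Gb powr (b / (?m + 1))"
      using ab by (intro powr_mono2) (auto intro: sum_nonneg)
  qed auto
  finally have "(\<Sum>i\<in>I. \<Sum>j\<in>J. z i j powr (?m / (?m + 1))) powr (1 + 1 / ?m)
     \<le> (Ga powr (a / (?m + 1)) * Gb powr (b / (?m + 1))) powr (1 + 1 / ?m)"
    using ab by (intro powr_mono2) (auto intro!: sum_nonneg)
  also have "\<dots> = Ga powr (a / ?m) * Gb powr (b / ?m)"
  proof -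
    have "a / (?m + 1) * (1 + 1 / ?m) = a / ?m" "b / (?m + 1) * (1 + 1 / ?m) = b / ?m"
    proof -
      have "1 + 1 / ?m = (?m + 1) / ?m" using nz by (simp add: add_divide_distrib)
      then show "a / (?m + 1) * (1 + 1 / ?m) = a / ?m" "b / (?m + 1) * (1 + 1 / ?m) = b / ?m"
        using cancel[of "?m + 1" _ ?m] nz by simp_all
    qed
    moreover have "(Ga powr x * Gb powr y) powr w = Ga powr (x * w) * Gb powr (y * w)" for x y w
      by (simp only: powr_mult powr_powr)
    ultimately show ?thesis by (simp only:)
  qed
  finally show ?thesis .
qed

section \<open>The two-point inequality\<close>

text \<open>
  The even Taylor coefficients of $(1+y)^p$ are nonnegative for $1 \le p \le 2$, so the sum of the two
  powers dominates its second order Taylor polynomial. Here two derivatives suffice: the second one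
  is nonnegative because $(1+t)^{p-2}$ and $(1-t)^{p-2}$ have product at least 1, hence sum at least 2.
\<close>
lemma Taylor_lower_bound_even_powr:
  fixes p y :: real
  assumes p: "1 \<le> p" "p \<le> 2" and y: "0 \<le> y" "y \<le> 1"
  shows "2 + p * (p - 1) * y\<^sup>2 \<le> (1 + y) powr p + (1 - y) powr p"
proof -
  define \<psi> where "\<psi> t = (1 + t) powr (p - 1) - (1 - t) powr (p - 1) - 2 * (p - 1) * t" for t
  define \<phi> where "\<phi> t = (1 + t) powr p + (1 - t) powr p - p * (p - 1) * t\<^sup>2" for t
  have dpsi: "(\<psi> has_real_derivative (p - 1) * ((1 + t) powr (p - 2) + (1 - t) powr (p - 2) - 2)) (at t)"
    if "0 < t" "t < 1" for t
    unfolding \<psi>_def using that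
    by (auto intro!: derivative_eq_intros simp: algebra_simps)
  have dpsi0: "0 \<le> (p - 1) * ((1 + t) powr (p - 2) + (1 - t) powr (p - 2) - 2)"
    if t: "0 < t" "t < 1" for t
  proof -
    let ?A = "(1 + t) powr (p - 2)" and ?B = "(1 - t) powr (p - 2)"
    have tt: "1 - t * t > 0" using t mult_strict_mono[of t 1 t 1] by simp
    have "?A * ?B = ((1 + t) * (1 - t)) powr (p - 2)" using t by (simp add: powr_mult)
    also have "\<dots> = (1 - t * t) powr (p - 2)" by (simp add: algebra_simps)
    also have "\<dots> \<ge> (1 - t * t) powr 0" using tt p by (intro powr_mono') auto
    finally have "1 \<le> ?A * ?B" using tt by simp
    moreover have "0 \<le> (?A - ?B)\<^sup>2" by simp
    ultimately have "2\<^sup>2 \<le> (?A + ?B)\<^sup>2" by (simp add: power2_eq_square algebra_simps)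
    then have "2 \<le> ?A + ?B" by (rule power2_le_imp_le) simp
    then show ?thesis using p by simp
  qed
  have psi0: "0 \<le> \<psi> t" if t: "0 < t" "t < 1" for t
  proof -
    have "\<psi> 0 \<le> \<psi> t"
    proof (rule DERIV_nonneg_imp_increasing_open[where f = \<psi>])
      show "continuous_on {0..t} \<psi>"
        unfolding \<psi>_def using t by (intro continuous_intros) auto
      show "\<exists>d. (\<psi> has_real_derivative d) (at x) \<and> 0 \<le> d" if "0 < x" "x < t" for x
      proof -
        have "x < 1" using that t by simp
        then show ?thesis using dpsi[of x] dpsi0[of x] that by blast
      qed
    qed (use t in auto)
    then show ?thesis by (simp add: \<psi>_def)
  qed
  have "\<phi> 0 \<le> \<phi> y"
  proof (rule DERIV_nonneg_imp_increasing_open[OF y(1)])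
    fix t assume t: "0 < t" "t < y"
    have "(\<phi> has_real_derivative p * \<psi> t) (at t)"
      unfolding \<psi>_def \<phi>_def using t y
      by (auto intro!: derivative_eq_intros simp: algebra_simps)
    then show "\<exists>d. (\<phi> has_real_derivative d) (at t) \<and> 0 \<le> d"
      using psi0[of t] t y p by (intro exI[of _ "p * \<psi> t"]) auto
  next
    show "continuous_on {0..y} \<phi>"
      unfolding \<phi>_def using p y by (intro continuous_intros continuous_on_powr') auto
  qed
  then show ?thesis by (simp add: \<phi>_def)
qed

text \<open>
  Hypercontractivity for one random sign. After scaling to $u = 1$, $0 \le v \le 1$, Bernoulli's
  inequality $(1 + (p-1)v^2)^{p/2} \le 1 + p(p-1)v^2/2$ meets the Taylor bound from below. For
  $|u| < |v|$ exchanging $u$ and $v$ only increases the left hand side, since $p - 1 \le 1$.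
\<close>
lemma two_point_inequality:
  fixes p u v :: real
  assumes p: "1 \<le> p" "p \<le> 2"
  shows "(u\<^sup>2 + (p - 1) * v\<^sup>2) powr (p / 2) \<le> (\<bar>u + v\<bar> powr p + \<bar>u - v\<bar> powr p) / 2"
proof -
  have main: "(u\<^sup>2 + (p - 1) * v\<^sup>2) powr (p / 2) \<le> (\<bar>u + v\<bar> powr p + \<bar>u - v\<bar> powr p) / 2"
    if uv: "\<bar>v\<bar> \<le> \<bar>u\<bar>" "u \<noteq> 0" for u v :: real
  proof -
    define y where "y = \<bar>v / u\<bar>"
    have y: "0 \<le> y" "y \<le> 1" using uv by (auto simp: y_def)
    have "(1 + (p - 1) * y\<^sup>2) powr (p / 2) * 1 powr (1 - p / 2) \<le> p / 2 * (1 + (p - 1) * y\<^sup>2) + (1 - p / 2) * 1"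
      using p by (intro Youngs_inequality_0) (auto intro: add_pos_nonneg)
    also have "\<dots> = (2 + p * (p - 1) * y\<^sup>2) / 2" by (simp add: field_simps)
    also have "\<dots> \<le> ((1 + y) powr p + (1 - y) powr p) / 2"
      using Taylor_lower_bound_even_powr[OF p y] by simp
    also have "(1 + y) powr p + (1 - y) powr p = \<bar>1 + v / u\<bar> powr p + \<bar>1 - v / u\<bar> powr p"
    proof -
      have "v / u = y \<or> v / u = - y" by (auto simp: y_def abs_if)
      then show ?thesis
      proof
        assume *: "v / u = y"
        show ?thesis unfolding * using y by simp
      next
        assume *: "v / u = - y"
        show ?thesis unfolding * using y by simp
      qed
    qed
    finally have *: "(1 + (p - 1) * y\<^sup>2) powr (p / 2) \<le> (\<bar>1 + v / u\<bar> powr p + \<bar>1 - v / u\<bar> powr p) / 2"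
      by simp
    have "(u\<^sup>2 + (p - 1) * v\<^sup>2) powr (p / 2) = (u\<^sup>2 * (1 + (p - 1) * y\<^sup>2)) powr (p / 2)"
    proof -
      have "u\<^sup>2 * y\<^sup>2 = v\<^sup>2" using uv by (simp add: y_def power_divide)
      then show ?thesis by (simp add: algebra_simps)
    qed
    also have "\<dots> = \<bar>u\<bar> powr p * (1 + (p - 1) * y\<^sup>2) powr (p / 2)"
    proof -
      have "\<bar>u\<bar> powr 2 = u\<^sup>2" using uv by (simp add: powr_numeral)
      then have "u\<^sup>2 powr (p / 2) = (\<bar>u\<bar> powr 2) powr (p / 2)" by simp
      also have "\<dots> = \<bar>u\<bar> powr p" by (simp only: powr_powr) simp
      finally show ?thesis using p by (simp add: powr_mult)
    qed
    also have "\<dots> \<le> \<bar>u\<bar> powr p * ((\<bar>1 + v / u\<bar> powr p + \<bar>1 - v / u\<bar> powr p) / 2)"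
      by (intro mult_left_mono *) auto
    also have "\<dots> = (\<bar>u * (1 + v / u)\<bar> powr p + \<bar>u * (1 - v / u)\<bar> powr p) / 2"
      by (simp only: abs_mult powr_mult distrib_left[of "\<bar>u\<bar> powr p"] times_divide_eq_right)
    also have "\<dots> = (\<bar>u + v\<bar> powr p + \<bar>u - v\<bar> powr p) / 2"
      using uv by (simp add: algebra_simps)
    finally show ?thesis .
  qed
  show ?thesis
  proof (cases "\<bar>v\<bar> \<le> \<bar>u\<bar>")
    case True
    then show ?thesis using main[of v u] by (cases "u = 0") auto
  next
    case False
    have "u\<^sup>2 \<le> v\<^sup>2" using False by (metis abs_le_square_iff linear)
    then have "(2 - p) * u\<^sup>2 \<le> (2 - p) * v\<^sup>2" using p by (intro mult_left_mono) auto
    then have "u\<^sup>2 + (p - 1) * v\<^sup>2 \<le> v\<^sup>2 + (p - 1) * u\<^sup>2" by (simp add: algebra_simps)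
    then have "(u\<^sup>2 + (p - 1) * v\<^sup>2) powr (p / 2) \<le> (v\<^sup>2 + (p - 1) * u\<^sup>2) powr (p / 2)"
      using p by (intro powr_mono2) auto
    also have "\<dots> \<le> (\<bar>v + u\<bar> powr p + \<bar>v - u\<bar> powr p) / 2"
      using False by (intro main) auto
    finally show ?thesis by (simp add: add.commute abs_minus_commute)
  qed
qed

section \<open>Walsh polynomials and averages over the cube\<close>

lemma square_powr_half: "(x\<^sup>2) powr (p / 2) = \<bar>x\<bar> powr p" for x p :: real
proof (cases "x = 0")
  case False
  then have "\<bar>x\<bar> powr 2 = x\<^sup>2" by (simp add: powr_numeral)
  then have "x\<^sup>2 powr (p / 2) = (\<bar>x\<bar> powr 2) powr (p / 2)" by simp
  then show ?thesis by (simp only: powr_powr) simp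
qed simp

lemma sum_Pow_insert:
  fixes f :: "'a set \<Rightarrow> 'b::comm_monoid_add"
  assumes "finite V" "i \<notin> V"
  shows "(\<Sum>S\<in>Pow (insert i V). f S) = (\<Sum>S\<in>Pow V. f S) + (\<Sum>S\<in>Pow V. f (insert i S))"
proof -
  have "inj_on (insert i) (Pow V)" using assms by (auto simp: inj_on_def)
  moreover have "Pow V \<inter> insert i ` Pow V = {}" using assms by auto
  ultimately show ?thesis
    using assms by (simp add: Pow_insert sum.union_disjoint sum.reindex)
qed

lemma sum_Pow_union:
  fixes f :: "'a set \<Rightarrow> 'b::comm_monoid_add"
  assumes "finite A" "finite B" "A \<inter> B = {}"
  shows "(\<Sum>S\<in>Pow (A \<union> B). f S) = (\<Sum>S\<in>Pow A. \<Sum>T\<in>Pow B. f (S \<union> T))"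
  using assms
proof (induction A arbitrary: f rule: finite_induct)
  case (insert i A)
  then have "(\<Sum>S\<in>Pow (insert i A \<union> B). f S)
      = (\<Sum>S\<in>Pow (A \<union> B). f S) + (\<Sum>S\<in>Pow (A \<union> B). f (insert i S))"
    using sum_Pow_insert[of "A \<union> B" i f] by simp
  then show ?case using insert by (simp add: sum_Pow_insert)
qed simp

definition walsh_poly :: "nat set \<Rightarrow> (nat set \<Rightarrow> real) \<Rightarrow> (nat \<Rightarrow> real) \<Rightarrow> real" where
  "walsh_poly V c x = (\<Sum>S\<in>Pow V. c S * walsh S x)"

text \<open>
  Subsets of the set of variables parametrise the vertices of the cube, so that averages over a cube
  in finitely many variables become sums over a power set, and splitting the variables into two
  blocks splits such a sum.
\<close>
definition sign_point :: "nat set \<Rightarrow> nat \<Rightarrow> real" where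
  "sign_point X j = (if j \<in> X then - 1 else 1)"

definition cube_avg :: "nat set \<Rightarrow> ((nat \<Rightarrow> real) \<Rightarrow> real) \<Rightarrow> real" where
  "cube_avg V h = (\<Sum>X\<in>Pow V. h (sign_point X)) / 2 ^ card V"

definition cube_bounded :: "nat set \<Rightarrow> (nat set \<Rightarrow> real) \<Rightarrow> real \<Rightarrow> bool" where
  "cube_bounded V c b \<longleftrightarrow> (\<forall>x. (\<forall>j\<in>V. x j \<in> {-1, 1}) \<longrightarrow> \<bar>walsh_poly V c x\<bar> \<le> b)"

lemma walsh_cong: "(\<And>j. j \<in> S \<Longrightarrow> x j = y j) \<Longrightarrow> walsh S x = walsh S y"
  by (simp add: walsh_def)

lemma walsh_poly_cong:
  assumes "\<And>S. S \<subseteq> V \<Longrightarrow> c S = d S" "\<And>j. j \<in> V \<Longrightarrow> x j = y j"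
  shows "walsh_poly V c x = walsh_poly V d y"
  unfolding walsh_poly_def
proof (intro sum.cong refl)
  fix S assume "S \<in> Pow V"
  then show "c S * walsh S x = d S * walsh S y"
    using assms walsh_cong[of S x y] by auto
qed

lemma walsh_poly_insert:
  assumes "finite V" "i \<notin> V"
  shows "walsh_poly (insert i V) c x = walsh_poly V c x + x i * walsh_poly V (\<lambda>S. c (insert i S)) x"
proof -
  have "walsh (insert i S) x = x i * walsh S x" if "S \<in> Pow V" for S
    using that assms finite_subset[of S V] by (subst walsh_def, subst prod.insert) (auto simp: walsh_def)
  then show ?thesis
    using assms by (simp add: walsh_poly_def sum_Pow_insert sum_distrib_left mult_ac cong: sum.cong_simp)
qed

lemma walsh_poly_union:
  assumes "finite A" "finite B" "A \<inter> B = {}"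
  shows "walsh_poly (A \<union> B) c x = walsh_poly A (\<lambda>S. walsh_poly B (\<lambda>T. c (S \<union> T)) x) x"
proof -
  have "walsh (S \<union> T) x = walsh S x * walsh T x" if "S \<in> Pow A" "T \<in> Pow B" for S T
    using that assms finite_subset[of S A] finite_subset[of T B]
    unfolding walsh_def by (intro prod.union_disjoint) auto
  then show ?thesis
    using assms by (simp add: walsh_poly_def sum_Pow_union sum_distrib_left sum_distrib_right mult_ac cong: sum.cong_simp)
qed

lemma sign_point_insert: "sign_point (insert i X) = (sign_point X)(i := - 1)"
  by (auto simp: sign_point_def fun_eq_iff)

lemma cube_avg_insert:
  assumes "finite V" "i \<notin> V"
  shows "cube_avg (insert i V) h = cube_avg V (\<lambda>x. (h (x(i := 1)) + h (x(i := - 1))) / 2)"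
proof -
  have "sign_point X = (sign_point X)(i := 1)" if "X \<in> Pow V" for X
    using that assms by (auto simp: sign_point_def fun_eq_iff)
  then have *: "(\<Sum>X\<in>Pow V. h (sign_point X)) = (\<Sum>X\<in>Pow V. h ((sign_point X)(i := 1)))"
    by (intro sum.cong) auto
  show ?thesis
    using assms unfolding cube_avg_def
    by (simp add: sum_Pow_insert sign_point_insert * sum.distrib flip: sum_divide_distrib)
qed

lemma cube_avg_mono:
  assumes "\<And>X. X \<subseteq> V \<Longrightarrow> h (sign_point X) \<le> k (sign_point X)"
  shows "cube_avg V h \<le> cube_avg V k"
  unfolding cube_avg_def using assms by (intro divide_right_mono sum_mono) auto

lemma cube_avg_nonneg: "(\<And>x. 0 \<le> h x) \<Longrightarrow> 0 \<le> cube_avg V h"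
  unfolding cube_avg_def by (intro divide_nonneg_nonneg sum_nonneg) auto

lemma cube_avg_sum: "cube_avg V (\<lambda>x. \<Sum>i\<in>I. h i x) = (\<Sum>i\<in>I. cube_avg V (h i))"
  unfolding cube_avg_def sum_divide_distrib [symmetric] by (subst sum.swap) (rule refl)

lemma cube_avg_const: "finite V \<Longrightarrow> cube_avg V (\<lambda>x. b) = b"
  by (simp add: cube_avg_def card_Pow)

lemma cube_avg_powr:
  assumes "finite V" "1 \<le> r" "\<And>x. 0 \<le> h x"
  shows "cube_avg V h powr r \<le> cube_avg V (\<lambda>x. h x powr r)"
  using powr_mean_le_mean_powr[of r "Pow V" "\<lambda>X. h (sign_point X)"] assms
  by (auto simp: cube_avg_def card_Pow)

lemma cube_avg_Minkowski:
  assumes V: "finite V" and r: "1 \<le> r" and nn: "\<And>x. 0 \<le> F x" "\<And>x. 0 \<le> G x"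
  shows "(cube_avg V F powr r + cube_avg V G powr r) powr (1 / r)
         \<le> cube_avg V (\<lambda>x. (F x powr r + G x powr r) powr (1 / r))"
proof -
  let ?N = "2 ^ card V :: real"
  define Y where "Y X t = (if t then F (sign_point X) else G (sign_point X)) / ?N" for X t
  have "(\<Sum>t\<in>UNIV. (\<Sum>X\<in>Pow V. Y X t) powr r) powr (1/r)
      \<le> (\<Sum>X\<in>Pow V. (\<Sum>t\<in>UNIV. Y X t powr r) powr (1/r))"
    using nn by (intro Minkowski_sum r) (auto simp: Y_def)
  moreover have "(\<Sum>t\<in>UNIV. (\<Sum>X\<in>Pow V. Y X t) powr r) = cube_avg V F powr r + cube_avg V G powr r"
    by (simp add: UNIV_bool Y_def cube_avg_def sum_divide_distrib)
  moreover have "(\<Sum>t\<in>UNIV. Y X t powr r) powr (1/r)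
       = (F (sign_point X) powr r + G (sign_point X) powr r) powr (1 / r) / ?N" for X
  proof -
    have "(\<Sum>t\<in>UNIV. Y X t powr r) = (F (sign_point X) powr r + G (sign_point X) powr r) / ?N powr r"
      using nn by (simp add: UNIV_bool Y_def powr_divide add_divide_distrib)
    then show ?thesis using r by (simp add: powr_divide powr_powr)
  qed
  ultimately show ?thesis by (simp add: cube_avg_def sum_divide_distrib)
qed

section \<open>Hypercontractivity\<close>

text \<open>
  The noise operator with parameter $\sqrt{p-1}$ is a contraction from $L_p$ to $L_2$. It tensorises:
  in the new variable $x_i$ the polynomial is $u + x_i v$, the two-point inequality treats $x_i$ for
  fixed values of the others, and Minkowski with exponent $2/p$ carries the average over the other
  variables inside, where the induction hypothesis applies to $u$ and $v$.
\<close>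
lemma Bonami_Beckner:
  assumes p: "1 \<le> p" "p \<le> 2" and V: "finite V"
  shows "(\<Sum>T\<in>Pow V. (p - 1) ^ card T * (c T)\<^sup>2) powr (p / 2)
         \<le> cube_avg V (\<lambda>x. \<bar>walsh_poly V c x\<bar> powr p)"
  using V
proof (induction V arbitrary: c rule: finite_induct)
  case empty
  then show ?case by (simp add: cube_avg_def walsh_poly_def walsh_def square_powr_half)
next
  case (insert i V)
  let ?c' = "\<lambda>S. c (insert i S)"
  define u where "u = walsh_poly V c"
  define v where "v = walsh_poly V ?c'"
  have wp: "walsh_poly (insert i V) c (x(i := t)) = u x + t * v x" for x t
  proof -
    have "walsh_poly V d (x(i := t)) = walsh_poly V d x" for d
      using insert by (intro walsh_poly_cong) auto
    then show ?thesis using insert by (simp add: walsh_poly_insert u_def v_def)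
  qed
  let ?s = "\<lambda>c. (\<Sum>T\<in>Pow V. (p - 1) ^ card T * (c T)\<^sup>2)"
  have s0: "0 \<le> ?s c" for c using p by (intro sum_nonneg) auto
  \<comment> \<open>the induction hypothesis, solved for the weighted sum of squares\<close>
  have root: "?s c \<le> cube_avg V (\<lambda>x. \<bar>walsh_poly V c x\<bar> powr p) powr (2 / p)" for c
  proof -
    have "(?s c powr (p / 2)) powr (2 / p) \<le> cube_avg V (\<lambda>x. \<bar>walsh_poly V c x\<bar> powr p) powr (2 / p)"
      using p insert.IH[of c] by (intro powr_mono2) auto
    then show ?thesis using p s0[of c] by (simp add: powr_powr)
  qed
  have card: "card (insert i T) = Suc (card T)" if "T \<in> Pow V" for T
    using that insert finite_subset[of T V] by (subst card_insert_disjoint) auto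
  have "(\<Sum>T\<in>Pow (insert i V). (p - 1) ^ card T * (c T)\<^sup>2) = ?s c + (p - 1) * ?s ?c'"
    using insert card by (simp add: sum_Pow_insert sum_distrib_left mult_ac cong: sum.cong_simp)
  also have "\<dots> \<le> cube_avg V (\<lambda>x. \<bar>u x\<bar> powr p) powr (2 / p)
             + (p - 1) * cube_avg V (\<lambda>x. \<bar>v x\<bar> powr p) powr (2 / p)"
    unfolding u_def v_def using p by (intro add_mono mult_left_mono root) auto
  \<comment> \<open>the factor $p - 1$ moves into the average, so that Minkowski applies to two averages\<close>
  also have "(p - 1) * cube_avg V (\<lambda>x. \<bar>v x\<bar> powr p) powr (2 / p)
      = cube_avg V (\<lambda>x. (p - 1) powr (p / 2) * \<bar>v x\<bar> powr p) powr (2 / p)"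
  proof -
    have "cube_avg V (\<lambda>x. (p - 1) powr (p / 2) * \<bar>v x\<bar> powr p)
        = (p - 1) powr (p / 2) * cube_avg V (\<lambda>x. \<bar>v x\<bar> powr p)"
      by (simp add: cube_avg_def sum_distrib_left)
    then show ?thesis using p by (simp add: powr_mult powr_powr)
  qed
  finally have "(\<Sum>T\<in>Pow (insert i V). (p - 1) ^ card T * (c T)\<^sup>2) powr (p / 2)
     \<le> (cube_avg V (\<lambda>x. \<bar>u x\<bar> powr p) powr (2 / p)
         + cube_avg V (\<lambda>x. (p - 1) powr (p / 2) * \<bar>v x\<bar> powr p) powr (2 / p)) powr (1 / (2 / p))"
    using p by (subst divide_divide_eq_right) (auto intro!: powr_mono2 sum_nonneg)
  also have "\<dots> \<le> cube_avg V (\<lambda>x. ((\<bar>u x\<bar> powr p) powr (2 / p)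
         + ((p - 1) powr (p / 2) * \<bar>v x\<bar> powr p) powr (2 / p)) powr (1 / (2 / p)))"
    using p by (intro cube_avg_Minkowski insert) auto
  also have "\<dots> \<le> cube_avg V (\<lambda>x. (\<bar>u x + v x\<bar> powr p + \<bar>u x - v x\<bar> powr p) / 2)"
  proof (intro cube_avg_mono)
    fix X
    let ?x = "sign_point X"
    have "(\<bar>u ?x\<bar> powr p) powr (2 / p) = (u ?x)\<^sup>2"
      using p by (simp add: powr_powr powr_numeral)
    moreover have "((p - 1) powr (p / 2) * \<bar>v ?x\<bar> powr p) powr (2 / p) = (p - 1) * (v ?x)\<^sup>2"
      using p by (simp add: powr_powr powr_mult powr_numeral)
    ultimately show "((\<bar>u ?x\<bar> powr p) powr (2 / p)
         + ((p - 1) powr (p / 2) * \<bar>v ?x\<bar> powr p) powr (2 / p)) powr (1 / (2 / p))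
        \<le> (\<bar>u ?x + v ?x\<bar> powr p + \<bar>u ?x - v ?x\<bar> powr p) / 2"
      using two_point_inequality[OF p] by simp
  qed
  also have "\<dots> = cube_avg (insert i V) (\<lambda>x. \<bar>walsh_poly (insert i V) c x\<bar> powr p)"
    using insert by (simp add: cube_avg_insert wp)
  finally show ?case .
qed

lemma cube_avg_square_walsh_poly:
  assumes V: "finite V"
  shows "cube_avg V (\<lambda>x. (walsh_poly V c x)\<^sup>2) = (\<Sum>T\<in>Pow V. (c T)\<^sup>2)"
  using V
proof (induction V arbitrary: c rule: finite_induct)
  case empty
  then show ?case by (simp add: cube_avg_def walsh_poly_def walsh_def)
next
  case (insert i V)
  let ?c' = "\<lambda>S. c (insert i S)"
  have wp: "walsh_poly (insert i V) c (x(i := t)) = walsh_poly V c x + t * walsh_poly V ?c' x" for x t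
  proof -
    have "walsh_poly V d (x(i := t)) = walsh_poly V d x" for d
      using insert by (intro walsh_poly_cong) auto
    then show ?thesis using insert by (simp add: walsh_poly_insert)
  qed
  have "cube_avg (insert i V) (\<lambda>x. (walsh_poly (insert i V) c x)\<^sup>2)
     = cube_avg V (\<lambda>x. (walsh_poly V c x)\<^sup>2 + (walsh_poly V ?c' x)\<^sup>2)"
  proof -
    have "((u + v)\<^sup>2 + (u - v)\<^sup>2) / 2 = u\<^sup>2 + v\<^sup>2" for u v :: real
      by (simp add: power2_eq_square algebra_simps)
    then show ?thesis using insert by (simp add: cube_avg_insert wp add_divide_distrib)
  qed
  also have "\<dots> = cube_avg V (\<lambda>x. (walsh_poly V c x)\<^sup>2) + cube_avg V (\<lambda>x. (walsh_poly V ?c' x)\<^sup>2)"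
    by (simp add: cube_avg_def sum.distrib add_divide_distrib)
  finally show ?case using insert by (simp add: sum_Pow_insert)
qed

text \<open>
  At $p = 1$ the weight $p - 1$ vanishes, and hypercontractivity sees only the constant coefficient.
  For polynomials of low degree the $L_1$ norm still controls the $L_2$ norm: $\|g\|_2 \le 3^{d/2} \|g\|_{4/3}$, while
  $\|g\|_{4/3} \le \|g\|_1^{1/2} \|g\|_2^{1/2}$ by Hoelder, and a power of $\|g\|_2$ cancels.
\<close>
lemma low_degree_moment_comparison:
  assumes p: "1 \<le> p" and V: "finite V"
    and deg: "\<And>T. T \<subseteq> V \<Longrightarrow> d < card T \<Longrightarrow> c T = 0"
  shows "(\<Sum>T\<in>Pow V. (1 / 9) ^ d * (c T)\<^sup>2) powr (p / 2)
         \<le> cube_avg V (\<lambda>x. \<bar>walsh_poly V c x\<bar> powr p)"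
proof -
  let ?g = "walsh_poly V c"
  define E where "E = (\<Sum>T\<in>Pow V. (c T)\<^sup>2)"
  define L where "L = cube_avg V (\<lambda>x. \<bar>?g x\<bar>)"
  have E0: "0 \<le> E" by (auto simp: E_def intro: sum_nonneg)
  have L0: "0 \<le> L" by (auto simp: L_def intro: cube_avg_nonneg)
  have key: "(1 / 9) ^ d * E \<le> L\<^sup>2"
  proof (cases "E = 0")
    case False
    then have Ep: "E > 0" using E0 by simp
    \<comment> \<open>$4/3$ is halfway between 1 and 2 in the sense $3/4 = 1/2 \cdot 1 + 1/2 \cdot 1/2$\<close>
    have "((1 / 3) ^ d * E) powr (2 / 3) \<le> (\<Sum>T\<in>Pow V. (4 / 3 - 1) ^ card T * (c T)\<^sup>2) powr ((4/3) / 2)"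
    proof -
      have "(1 / 3) ^ d * E \<le> (\<Sum>T\<in>Pow V. (4 / 3 - 1) ^ card T * (c T)\<^sup>2)"
        unfolding E_def sum_distrib_left
      proof (intro sum_mono)
        fix T assume "T \<in> Pow V"
        then show "(1 / 3) ^ d * (c T)\<^sup>2 \<le> (4 / 3 - 1) ^ card T * (c T)\<^sup>2"
          using deg[of T] by (cases "card T \<le> d") (auto intro!: mult_right_mono power_decreasing)
      qed
      then show ?thesis using E0 by (simp add: powr_mono2)
    qed
    also have "\<dots> \<le> cube_avg V (\<lambda>x. \<bar>?g x\<bar> powr (4/3))"
      using V by (intro Bonami_Beckner) auto
    also have "\<dots> \<le> L powr (2/3) * cube_avg V (\<lambda>x. (?g x)\<^sup>2) powr (1/3)"
    proof -
      have "\<bar>t\<bar> powr (4/3) = \<bar>t\<bar> powr (2/3) * (t\<^sup>2) powr (1/3)" for t :: real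
        using square_powr_half[of t "2/3"] by (simp flip: powr_add)
      then have "(\<Sum>X\<in>Pow V. \<bar>?g (sign_point X)\<bar> powr (4/3))
        \<le> (\<Sum>X\<in>Pow V. \<bar>?g (sign_point X)\<bar>) powr (2/3) * (\<Sum>X\<in>Pow V. (?g (sign_point X))\<^sup>2) powr (1/3)"
        using Hoelder_sum[of "2/3" "1/3" "Pow V" "\<lambda>X. \<bar>?g (sign_point X)\<bar>" "\<lambda>X. (?g (sign_point X))\<^sup>2"]
        by simp
      moreover have "(2 ^ card V :: real) = (2 ^ card V) powr (2/3) * (2 ^ card V) powr (1/3)"
        by (simp flip: powr_add)
      ultimately show ?thesis
        unfolding L_def cube_avg_def 
        by (simp add: powr_divide sum_nonneg divide_right_mono)
    qed
    also have "cube_avg V (\<lambda>x. (?g x)\<^sup>2) = E"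
      using V by (simp add: cube_avg_square_walsh_poly E_def)
    finally have "((1 / 3) ^ d) powr (2/3) * E powr (2/3) \<le> L powr (2/3) * E powr (1/3)"
      by (simp add: powr_mult)
    moreover have "E powr (2/3) = E powr (1/3) * E powr (1/3)"
      using Ep by (simp flip: powr_add)
    ultimately have "(((1 / 3) ^ d) powr (2/3) * E powr (1/3)) * E powr (1/3) \<le> L powr (2/3) * E powr (1/3)"
      by simp
    then have "((1 / 3) ^ d) powr (2/3) * E powr (1/3) \<le> L powr (2/3)"
      using Ep by (auto dest: mult_right_le_imp_le)
    then have "(((1 / 3) ^ d) powr (2/3) * E powr (1/3)) powr 3 \<le> (L powr (2/3)) powr 3"
      by (intro powr_mono2) auto
    then have "((1 / 3) ^ d)\<^sup>2 * E \<le> L\<^sup>2"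
      using E0 L0 by (simp add: powr_mult powr_powr powr_numeral)
    moreover have "((1 / 3) ^ d)\<^sup>2 = (1 / 9 :: real) ^ d"
      by (simp add: power2_eq_square power_mult_distrib[symmetric])
    ultimately show ?thesis by simp
  qed (simp add: L_def)
  have "(\<Sum>T\<in>Pow V. (1 / 9) ^ d * (c T)\<^sup>2) powr (p / 2) \<le> (L\<^sup>2) powr (p / 2)"
    using key p by (intro powr_mono2) (auto simp: E_def sum_distrib_left intro: sum_nonneg)
  also have "\<dots> = L powr p" using L0 by (simp add: square_powr_half)
  also have "\<dots> \<le> cube_avg V (\<lambda>x. \<bar>?g x\<bar> powr p)"
    unfolding L_def using V p by (intro cube_avg_powr) auto
  finally show ?thesis .
qed

lemma cube_boundedD:
  "cube_bounded V c b \<Longrightarrow> (\<And>j. j \<in> V \<Longrightarrow> x j \<in> {-1, 1}) \<Longrightarrow> \<bar>walsh_poly V c x\<bar> \<le> b"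
  unfolding cube_bounded_def by blast

lemma cube_bounded_nonneg:
  assumes "cube_bounded V c b" shows "0 \<le> b"
proof -
  have "\<bar>walsh_poly V c (\<lambda>_. 1)\<bar> \<le> b" using assms by (rule cube_boundedD) simp
  then show ?thesis by linarith
qed

text \<open>
  A Walsh polynomial is affine in each variable, so its modulus on the solid cube is largest at a
  vertex. This makes the values at $\rho x$ with $|\rho| \le 1$ available.
\<close>
lemma cube_bounded_solid:
  assumes "finite V" "cube_bounded V c b" "\<And>j. j \<in> V \<Longrightarrow> \<bar>x j\<bar> \<le> 1"
  shows "\<bar>walsh_poly V c x\<bar> \<le> b"
  using assms
proof (induction V arbitrary: c rule: finite_induct)
  case empty
  then show ?case by (simp add: cube_bounded_def)
next
  case (insert i V)
  let ?c' = "\<lambda>S. c (insert i S)"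
  have *: "\<bar>walsh_poly V c x + t * walsh_poly V ?c' x\<bar> \<le> b" if t: "t \<in> {-1, 1}" for t
  proof -
    have comb: "walsh_poly V (\<lambda>S. c S + t * ?c' S) y = walsh_poly V c y + t * walsh_poly V ?c' y" for y
      by (simp add: walsh_poly_def sum.distrib sum_distrib_left algebra_simps)
    have "cube_bounded V (\<lambda>S. c S + t * ?c' S) b"
      unfolding cube_bounded_def
    proof (intro allI impI)
      fix y :: "nat \<Rightarrow> real" assume y: "\<forall>j\<in>V. y j \<in> {-1, 1}"
      have "\<bar>walsh_poly (insert i V) c (y(i := t))\<bar> \<le> b"
        using insert.prems(1) by (rule cube_boundedD) (use y t in auto)
      moreover have "walsh_poly V d (y(i := t)) = walsh_poly V d y" for d
        using insert by (intro walsh_poly_cong) auto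
      ultimately show "\<bar>walsh_poly V (\<lambda>S. c S + t * ?c' S) y\<bar> \<le> b"
        using insert.hyps by (simp add: walsh_poly_insert comb)
    qed
    then have "\<bar>walsh_poly V (\<lambda>S. c S + t * ?c' S) x\<bar> \<le> b"
      using insert by blast
    then show ?thesis by (simp add: comb)
  qed
  have "\<bar>x i * walsh_poly V ?c' x\<bar> \<le> \<bar>walsh_poly V ?c' x\<bar>"
    using insert.prems(2)[of i] mult_left_le_one_le[of "\<bar>walsh_poly V ?c' x\<bar>" "\<bar>x i\<bar>"] by (simp add: abs_mult)
  then show ?case using *[of 1] *[of "-1"] insert.hyps by (simp add: walsh_poly_insert)
qed

section \<open>Splitting the variables into two blocks\<close>

text \<open>
  The square of the $\ell_{p_a}$ norm of the coefficients on the sets of size $a$, where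
  $p_a = 2a/(a+1)$: the coefficients enter through their squares, which turns the exponent $p_a$ into
  $a/(a+1)$ and the outer exponent $2/p_a$ into $1 + 1/a$.
\<close>
definition level_norm :: "nat set \<Rightarrow> (nat set \<Rightarrow> real) \<Rightarrow> nat \<Rightarrow> real" where
  "level_norm V c a =
     (\<Sum>S | S \<subseteq> V \<and> card S = a. ((c S)\<^sup>2) powr (real a / (real a + 1))) powr (1 + 1 / real a)"

text \<open>
  The quantity that is propagated. Summing squares over the levels is what makes the induction
  lossless: the squared norms of all pairs of levels $(a, b)$ of a split function are controlled at
  once, so the many ways to write $m = a + b$ cost nothing. Bounding the levels one at a time would
  lose the probability of one value of $a$, a power of $m$ at each of the $\log m$ scales.
\<close>
definition level_bound :: "nat \<Rightarrow> nat \<Rightarrow> real \<Rightarrow> bool" where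
  "level_bound M N \<beta> \<longleftrightarrow>
     (\<forall>V c b. finite V \<longrightarrow> (\<forall>S\<subseteq>V. M < card S \<longrightarrow> c S = 0) \<longrightarrow> cube_bounded V c b \<longrightarrow>
        (\<Sum>a=1..N. level_norm V c a) \<le> \<beta> * b\<^sup>2)"

text \<open>
  The form of hypercontractivity that the splitting argument consumes. It has two instances: the
  noise weight $(p_a - 1)^b$ for arbitrary degree, and a constant weight for bounded degree.
\<close>
definition moment_weight :: "nat \<Rightarrow> nat \<Rightarrow> (nat \<Rightarrow> nat \<Rightarrow> real) \<Rightarrow> bool" where
  "moment_weight M N \<sigma> \<longleftrightarrow> (\<forall>a b. 0 \<le> \<sigma> a b) \<and>
     (\<forall>a\<in>{1..N}. \<forall>V c. finite V \<longrightarrow> (\<forall>S\<subseteq>V. M < card S \<longrightarrow> c S = 0) \<longrightarrow>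
        (\<Sum>T\<in>Pow V. \<sigma> a (card T) * (c T)\<^sup>2) powr (real a / (real a + 1))
        \<le> cube_avg V (\<lambda>x. \<bar>walsh_poly V c x\<bar> powr (2 * (real a / (real a + 1)))))"

lemma moment_weightD:
  assumes "moment_weight M N \<sigma>" "a \<in> {1..N}" "finite V" "\<forall>S\<subseteq>V. M < card S \<longrightarrow> c S = 0"
  shows "(\<Sum>T\<in>Pow V. \<sigma> a (card T) * (c T)\<^sup>2) powr (real a / (real a + 1))
        \<le> cube_avg V (\<lambda>x. \<bar>walsh_poly V c x\<bar> powr (2 * (real a / (real a + 1))))"
  using assms unfolding moment_weight_def by blast

text \<open>
  The square of the norm in $\ell_{p_a}(\ell_2)$ of the coefficients with $a$ variables in $A$, which
  index the outer norm, and $b$ variables in $B$.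
\<close>
definition mixed_norm :: "nat set \<Rightarrow> nat set \<Rightarrow> (nat set \<Rightarrow> real) \<Rightarrow> nat \<Rightarrow> nat \<Rightarrow> real" where
  "mixed_norm A B c a b =
     (\<Sum>S | S \<subseteq> A \<and> card S = a. (\<Sum>T | T \<subseteq> B \<and> card T = b. (c (S \<union> T))\<^sup>2)
        powr (real a / (real a + 1))) powr (1 + 1 / real a)"

text \<open>
  The square of the $\ell_{p_{a+b}}$ norm of the same coefficients; its $p_m/2$-th powers, summed over
  all $a + b = m$, give that of level $m$.
\<close>
definition split_norm :: "nat set \<Rightarrow> nat set \<Rightarrow> (nat set \<Rightarrow> real) \<Rightarrow> nat \<Rightarrow> nat \<Rightarrow> real" where
  "split_norm A B c a b =
     (\<Sum>S | S \<subseteq> A \<and> card S = a. \<Sum>T | T \<subseteq> B \<and> card T = b.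
        ((c (S \<union> T))\<^sup>2) powr (real (a + b) / (real (a + b) + 1))) powr (1 + 1 / real (a + b))"

lemma finite_subsets_card [simp]: "finite V \<Longrightarrow> finite {S. S \<subseteq> V \<and> card S = a}"
  by (rule finite_subset[of _ "Pow V"]) auto

lemma level_exponents:
  assumes "1 \<le> (a::nat)"
  shows "1 / (1 + 1 / real a) = real a / (real a + 1)"
    and "real a / (real a + 1) * (1 + 1 / real a) = 1"
    and "(1 + 1 / real a) * (real a / (real a + 1)) = 1"
proof -
  have "1 + 1 / real a = (real a + 1) / real a" using assms by (simp add: add_divide_distrib)
  then show "1 / (1 + 1 / real a) = real a / (real a + 1)"
    and "real a / (real a + 1) * (1 + 1 / real a) = 1"
    and "(1 + 1 / real a) * (real a / (real a + 1)) = 1" using assms by auto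
qed

text \<open>
  Minkowski with exponent $2/p_a \ge 1$: the norm $\ell_{p_a}(\ell_2)$ dominates $\ell_2(\ell_{p_a})$, so
  the contributions of the different sizes $b$ of the inner sets can be pulled out of the norm and
  summed.
\<close>
lemma sum_mixed_norm_le:
  assumes a: "1 \<le> a" and fin: "finite A" "finite B" "finite J" and \<sigma>: "\<And>b. 0 \<le> \<sigma> b"
  shows "(\<Sum>b\<in>J. \<sigma> b * mixed_norm A B c a b)
         \<le> (\<Sum>S | S \<subseteq> A \<and> card S = a. (\<Sum>T\<in>Pow B. \<sigma> (card T) * (c (S \<union> T))\<^sup>2)
              powr (real a / (real a + 1))) powr (1 + 1 / real a)"
proof -
  let ?s = "real a / (real a + 1)" and ?r = "1 + 1 / real a"
  let ?I = "{S. S \<subseteq> A \<and> card S = a}"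
  define X where "X S b = (\<Sum>T | T \<subseteq> B \<and> card T = b. (c (S \<union> T))\<^sup>2)" for S b
  have X0: "0 \<le> X S b" for S b by (auto simp: X_def intro: sum_nonneg)
  note e = level_exponents[OF a]
  have r1: "1 \<le> ?r" by simp
  define Y where "Y S b = (\<sigma> b * X S b) powr ?s" for S b
  have Yr: "Y S b powr ?r = \<sigma> b * X S b" for S b
    unfolding Y_def powr_powr e using X0 \<sigma> by simp
  have "\<sigma> b * mixed_norm A B c a b = (\<Sum>S\<in>?I. Y S b) powr ?r" for b
  proof -
    have "(\<Sum>S\<in>?I. Y S b) = \<sigma> b powr ?s * (\<Sum>S\<in>?I. X S b powr ?s)"
      by (simp add: Y_def powr_mult sum_distrib_left)
    then have "(\<Sum>S\<in>?I. Y S b) powr ?r = (\<sigma> b powr ?s) powr ?r * (\<Sum>S\<in>?I. X S b powr ?s) powr ?r"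
      by (simp only: powr_mult)
    then show ?thesis
      unfolding powr_powr e mixed_norm_def X_def[symmetric] using \<sigma>[of b] by simp
  qed
  then have "(\<Sum>b\<in>J. \<sigma> b * mixed_norm A B c a b) = ((\<Sum>b\<in>J. (\<Sum>S\<in>?I. Y S b) powr ?r) powr (1 / ?r)) powr ?r"
    using e r1 by (simp only: powr_powr) (simp add: sum_nonneg)
  also have "\<dots> \<le> (\<Sum>S\<in>?I. (\<Sum>b\<in>J. Y S b powr ?r) powr (1 / ?r)) powr ?r"
    using r1 by (intro powr_mono2 Minkowski_sum) (auto simp: Y_def)
  also have "\<dots> \<le> (\<Sum>S\<in>?I. (\<Sum>T\<in>Pow B. \<sigma> (card T) * (c (S \<union> T))\<^sup>2) powr ?s) powr ?r"
  proof (intro powr_mono2 sum_mono)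
    fix S assume "S \<in> ?I"
    have "(\<Sum>b\<in>J. Y S b powr ?r) = (\<Sum>b\<in>J. \<Sum>T | T \<subseteq> B \<and> card T = b. \<sigma> (card T) * (c (S \<union> T))\<^sup>2)"
      by (simp add: Yr X_def sum_distrib_left)
    also have "\<dots> = (\<Sum>T\<in>(\<Union>b\<in>J. {T. T \<subseteq> B \<and> card T = b}). \<sigma> (card T) * (c (S \<union> T))\<^sup>2)"
      using fin by (intro sum.UNION_disjoint[symmetric]) auto
    also have "\<dots> \<le> (\<Sum>T\<in>Pow B. \<sigma> (card T) * (c (S \<union> T))\<^sup>2)"
      using fin \<sigma> by (intro sum_mono2) auto
    finally show "(\<Sum>b\<in>J. Y S b powr ?r) powr (1 / ?r)
        \<le> (\<Sum>T\<in>Pow B. \<sigma> (card T) * (c (S \<union> T))\<^sup>2) powr ?s"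
      unfolding e by (intro powr_mono2) (auto intro: sum_nonneg)
  qed (auto intro: sum_nonneg)
  finally show ?thesis .
qed

text \<open>
  Fix the variables in $B$ at $y$ and apply the hypothesis to the function of the variables in $A$
  that remains; its coefficients are functions $g_S(y)$. Average over $y$: convexity moves the average
  inside the outer power, and the moment inequality replaces the $p_a$-th moment of $g_S$ by a weighted
  $\ell_2$ norm of its coefficients.
\<close>
lemma weighted_mixed_norm_bound:
  assumes lb: "level_bound M N \<beta>" and mw: "moment_weight M N \<sigma>"
    and fin: "finite A" "finite B" "A \<inter> B = {}" "finite J"
    and deg: "\<forall>S\<subseteq>A \<union> B. M < card S \<longrightarrow> c S = 0"
    and bd: "cube_bounded (A \<union> B) c u"
  shows "(\<Sum>a=1..N. \<Sum>b\<in>J. \<sigma> a b * mixed_norm A B c a b) \<le> \<beta> * u\<^sup>2"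
proof -
  define g where "g x S = walsh_poly B (\<lambda>T. c (S \<union> T)) x" for x S
  have "(\<Sum>b\<in>J. \<sigma> a b * mixed_norm A B c a b) \<le> cube_avg B (\<lambda>x. level_norm A (g x) a)"
    if a: "a \<in> {1..N}" for a
  proof -
    let ?s = "real a / (real a + 1)" and ?r = "1 + 1 / real a"
    let ?I = "{S. S \<subseteq> A \<and> card S = a}"
    have "(\<Sum>b\<in>J. \<sigma> a b * mixed_norm A B c a b)
        \<le> (\<Sum>S\<in>?I. (\<Sum>T\<in>Pow B. \<sigma> a (card T) * (c (S \<union> T))\<^sup>2) powr ?s) powr ?r"
      using a fin mw by (intro sum_mixed_norm_le) (auto simp: moment_weight_def)
    also have "\<dots> \<le> (\<Sum>S\<in>?I. cube_avg B (\<lambda>x. \<bar>g x S\<bar> powr (2 * ?s))) powr ?r"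
    proof (intro powr_mono2 sum_mono)
      fix S assume S: "S \<in> ?I"
      have "\<forall>T\<subseteq>B. M < card T \<longrightarrow> c (S \<union> T) = 0"
      proof (intro allI impI)
        fix T assume T: "T \<subseteq> B" "M < card T"
        have "card T \<le> card (S \<union> T)"
          using S T fin by (intro card_mono) (auto intro: finite_subset)
        then have "M < card (S \<union> T)" "S \<union> T \<subseteq> A \<union> B" using S T by auto
        then show "c (S \<union> T) = 0" using deg by blast
      qed
      then show "(\<Sum>T\<in>Pow B. \<sigma> a (card T) * (c (S \<union> T))\<^sup>2) powr ?s
          \<le> cube_avg B (\<lambda>x. \<bar>g x S\<bar> powr (2 * ?s))"
        unfolding g_def by (rule moment_weightD[OF mw a fin(2)])
    qed (auto intro: sum_nonneg)
    also have "\<dots> = cube_avg B (\<lambda>x. \<Sum>S\<in>?I. \<bar>g x S\<bar> powr (2 * ?s)) powr ?r"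
      by (simp add: cube_avg_sum)
    also have "\<dots> \<le> cube_avg B (\<lambda>x. (\<Sum>S\<in>?I. \<bar>g x S\<bar> powr (2 * ?s)) powr ?r)"
      using fin by (intro cube_avg_powr) (auto intro: sum_nonneg)
    also have "\<dots> = cube_avg B (\<lambda>x. level_norm A (g x) a)"
    proof -
      have "\<bar>t\<bar> powr (2 * s) = (t\<^sup>2) powr s" for t s :: real
        using square_powr_half[of t "2 * s"] by simp
      then show ?thesis by (simp only: level_norm_def)
    qed
    finally show ?thesis .
  qed
  then have "(\<Sum>a=1..N. \<Sum>b\<in>J. \<sigma> a b * mixed_norm A B c a b)
      \<le> (\<Sum>a=1..N. cube_avg B (\<lambda>x. level_norm A (g x) a))"
    by (intro sum_mono)
  also have "\<dots> = cube_avg B (\<lambda>x. \<Sum>a=1..N. level_norm A (g x) a)"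
    by (simp add: cube_avg_sum)
  also have "\<dots> \<le> cube_avg B (\<lambda>x. \<beta> * u\<^sup>2)"
  proof (intro cube_avg_mono)
    fix Y
    have "cube_bounded A (g (sign_point Y)) u"
      unfolding cube_bounded_def
    proof (intro allI impI)
      fix x :: "nat \<Rightarrow> real" assume x: "\<forall>j\<in>A. x j \<in> {-1, 1}"
      \<comment> \<open>glue $x$ on $A$ and the frozen signs on $B$ to a vertex of the full cube\<close>
      define z where "z j = (if j \<in> A then x j else sign_point Y j)" for j
      have "walsh_poly B d z = walsh_poly B d (sign_point Y)" for d
        using fin by (intro walsh_poly_cong) (auto simp: z_def)
      moreover have "walsh_poly A d z = walsh_poly A d x" for d
        by (intro walsh_poly_cong) (auto simp: z_def)
      ultimately have "walsh_poly (A \<union> B) c z = walsh_poly A (g (sign_point Y)) x"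
        using fin by (simp add: walsh_poly_union g_def[abs_def])
      moreover have "\<bar>walsh_poly (A \<union> B) c z\<bar> \<le> u"
        using bd by (rule cube_boundedD) (use x in \<open>auto simp: z_def sign_point_def\<close>)
      ultimately show "\<bar>walsh_poly A (g (sign_point Y)) x\<bar> \<le> u" by simp
    qed
    moreover have "\<forall>S\<subseteq>A. M < card S \<longrightarrow> g (sign_point Y) S = 0"
    proof (intro allI impI)
      fix S assume S: "S \<subseteq> A" "M < card S"
      have "c (S \<union> T) = 0" if T: "T \<in> Pow B" for T
      proof -
        have "card S \<le> card (S \<union> T)"
          using S T fin by (intro card_mono) (auto intro: finite_subset)
        then have "M < card (S \<union> T)" "S \<union> T \<subseteq> A \<union> B" using S T by auto
        then show "c (S \<union> T) = 0" using deg by blast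
      qed
      then show "g (sign_point Y) S = 0" by (simp add: g_def walsh_poly_def)
    qed
    ultimately show "(\<Sum>a=1..N. level_norm A (g (sign_point Y)) a) \<le> \<beta> * u\<^sup>2"
      using lb fin unfolding level_bound_def by blast
  qed
  also have "\<dots> = \<beta> * u\<^sup>2" using fin by (simp add: cube_avg_const)
  finally show ?thesis .
qed

lemma split_norm_le_mixed_norms:
  assumes "1 \<le> a" "1 \<le> b"
  shows "split_norm A B c a b
         \<le> mixed_norm A B c a b powr (a / (a + b)) * mixed_norm B A c b a powr (b / (a + b))"
  using Blei_interpolation[of "real a" "real b" "{S. S \<subseteq> A \<and> card S = a}" "{T. T \<subseteq> B \<and> card T = b}"
      "\<lambda>S T. (c (S \<union> T))\<^sup>2"] assms
  by (simp add: split_norm_def mixed_norm_def Un_commute)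

text \<open>
  The weights that the two blocks lose in Blei's interpolation amount to a factor at most $\kappa$.
\<close>
definition balance_cost :: "(nat \<Rightarrow> nat \<Rightarrow> real) \<Rightarrow> real \<Rightarrow> nat \<Rightarrow> nat \<Rightarrow> bool" where
  "balance_cost \<sigma> \<kappa> a b \<longleftrightarrow> 1 \<le> \<kappa> * (\<sigma> a b powr (a / (a + b)) * \<sigma> b a powr (b / (a + b)))"

lemma split_norm_le_weighted:
  assumes ab: "1 \<le> a" "1 \<le> b" and \<sigma>: "0 \<le> \<sigma> a b" "0 \<le> \<sigma> b a" and \<kappa>: "0 \<le> \<kappa>" "balance_cost \<sigma> \<kappa> a b"
  shows "split_norm A B c a b \<le> \<kappa> * (\<sigma> a b * mixed_norm A B c a b + \<sigma> b a * mixed_norm B A c b a)"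
proof -
  let ?G = "mixed_norm A B c a b" and ?H = "mixed_norm B A c b a"
  let ?x = "a / (a + b)" and ?y = "b / (a + b)"
  have GH: "0 \<le> ?G" "0 \<le> ?H" by (simp_all add: mixed_norm_def)
  have xy: "0 \<le> ?x" "0 \<le> ?y" "?x + ?y = 1" "?x \<le> 1" "?y \<le> 1"
    using ab by (auto simp: add_divide_distrib[symmetric])
  have "split_norm A B c a b \<le> 1 * (?G powr ?x * ?H powr ?y)"
    using split_norm_le_mixed_norms[OF ab] by simp
  also have "\<dots> \<le> (\<kappa> * (\<sigma> a b powr ?x * \<sigma> b a powr ?y)) * (?G powr ?x * ?H powr ?y)"
    using \<kappa>(2) unfolding balance_cost_def by (intro mult_right_mono) auto
  also have "\<dots> = \<kappa> * ((\<sigma> a b * ?G) powr ?x * (\<sigma> b a * ?H) powr ?y)"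
    by (simp add: powr_mult)
  also have "\<dots> \<le> \<kappa> * (\<sigma> a b * ?G + \<sigma> b a * ?H)"
  proof (intro mult_left_mono \<kappa>)
    have "p powr ?x * q powr ?y \<le> p + q" if "0 \<le> p" "0 \<le> q" for p q
    proof (cases "p = 0 \<or> q = 0")
      case False
      then have "p powr ?x * q powr ?y \<le> ?x * p + ?y * q"
        using that xy by (intro Youngs_inequality_0) auto
      also have "\<dots> \<le> 1 * p + 1 * q" using that xy by (intro add_mono mult_right_mono) auto
      finally show ?thesis by simp
    qed (use that in auto)
    then show "(\<sigma> a b * ?G) powr ?x * (\<sigma> b a * ?H) powr ?y \<le> \<sigma> a b * ?G + \<sigma> b a * ?H"
      using GH \<sigma> by auto
  qed
  finally show ?thesis .
qed

text \<open>
  The mixed norm estimate is used twice, with $A$ and with $B$ as the outer block. The geometric mean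
  produced by Blei's inequality is bounded by the sum of the two, and summing over all pairs of levels
  only adds up the two estimates.
\<close>
lemma sum_split_norm_bound:
  assumes lb: "level_bound M N \<beta>" and mw: "moment_weight M N \<sigma>"
    and fin: "finite A" "finite B" "A \<inter> B = {}"
    and deg: "\<forall>S\<subseteq>A \<union> B. M < card S \<longrightarrow> c S = 0"
    and bd: "cube_bounded (A \<union> B) c u"
    and I: "finite I" and \<kappa>: "0 \<le> \<kappa>"
    and good: "\<And>m a. m \<in> I \<Longrightarrow> a \<in> good m \<Longrightarrow>
      a \<in> {1..N} \<and> m - a \<in> {1..N} \<and> balance_cost \<sigma> \<kappa> a (m - a)"
  shows "(\<Sum>m\<in>I. \<Sum>a\<in>good m. split_norm A B c a (m - a)) \<le> 2 * \<kappa> * \<beta> * u\<^sup>2"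
proof -
  have \<sigma>: "0 \<le> \<sigma> a b" for a b using mw by (auto simp: moment_weight_def)
  have gfin: "finite (good m)" if "m \<in> I" for m
    by (rule finite_subset[of _ "{1..N}"]) (use good that in auto)
  let ?F = "\<lambda>a b. \<kappa> * (\<sigma> a b * mixed_norm A B c a b + \<sigma> b a * mixed_norm B A c b a)"
  have F0: "0 \<le> ?F a b" for a b
    using \<kappa> \<sigma> by (simp add: mixed_norm_def)
  have "(\<Sum>m\<in>I. \<Sum>a\<in>good m. split_norm A B c a (m - a)) \<le> (\<Sum>m\<in>I. \<Sum>a\<in>good m. ?F a (m - a))"
    using good \<sigma> \<kappa> by (intro sum_mono split_norm_le_weighted) fastforce+
  also have "\<dots> = (\<Sum>(m, a)\<in>Sigma I good. ?F a (m - a))"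
    using I gfin by (simp add: sum.Sigma)
  also have "\<dots> = (\<Sum>(a, b)\<in>(\<lambda>(m, a). (a, m - a)) ` Sigma I good. ?F a b)"
  proof (subst sum.reindex)
    show "inj_on (\<lambda>(m, a). (a, m - a)) (Sigma I good)"
    proof (rule inj_onI, clarify)
      fix m a m' assume "m \<in> I" "a \<in> good m" "m' \<in> I" "a \<in> good m'" "m - a = m' - a"
      then show "m = m' \<and> a = a" using good[of m a] good[of m' a] by auto
    qed
  qed (auto simp: case_prod_beta intro!: sum.cong)
  also have "\<dots> \<le> (\<Sum>(a, b)\<in>{1..N} \<times> {1..N}. ?F a b)"
    using good F0 by (intro sum_mono2) (auto simp: image_subset_iff)
  also have "\<dots> = (\<Sum>a=1..N. \<Sum>b=1..N. ?F a b)"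
    by (simp add: sum.Sigma)
  also have "\<dots> = \<kappa> * ((\<Sum>a=1..N. \<Sum>b=1..N. \<sigma> a b * mixed_norm A B c a b)
                   + (\<Sum>a=1..N. \<Sum>b=1..N. \<sigma> b a * mixed_norm B A c b a))"
    by (simp only: sum.distrib sum_distrib_left distrib_left)
  also have "(\<Sum>a=1..N. \<Sum>b=1..N. \<sigma> b a * mixed_norm B A c b a)
       = (\<Sum>b=1..N. \<Sum>a=1..N. \<sigma> b a * mixed_norm B A c b a)"
    by (rule sum.swap)
  also have "\<kappa> * ((\<Sum>a=1..N. \<Sum>b=1..N. \<sigma> a b * mixed_norm A B c a b) + \<dots>) \<le> \<kappa> * (\<beta> * u\<^sup>2 + \<beta> * u\<^sup>2)"
    using fin deg bd
    by (intro mult_left_mono add_mono \<kappa> weighted_mixed_norm_bound[OF lb mw]) (auto simp: Un_commute Int_commute)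
  finally show ?thesis by (simp add: algebra_simps)
qed

text \<open>
  A uniformly random block meets a given set of size $m$ in a binomially distributed number of points.
\<close>
lemma card_subsets_meeting:
  assumes V: "finite V" and U: "U \<subseteq> V" "card U = m"
  shows "card {A \<in> Pow V. card (U \<inter> A) = a} = (m choose a) * 2 ^ (card V - m)"
proof -
  have finU: "finite U" using V U finite_subset by auto
  have "card {A \<in> Pow V. card (U \<inter> A) = a} = (\<Sum>A\<in>Pow V. if card (U \<inter> A) = a then 1 else 0)"
    using V by (simp add: sum.If_cases Int_def)
  also have "\<dots> = (\<Sum>A\<in>Pow (U \<union> (V - U)). if card (U \<inter> A) = a then 1 else 0)"
    using U by (simp add: Un_absorb1)
  also have "\<dots> = (\<Sum>S\<in>Pow U. \<Sum>T\<in>Pow (V - U). if card (U \<inter> (S \<union> T)) = a then 1 else 0)"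
    using V finU by (intro sum_Pow_union) auto
  also have "\<dots> = (\<Sum>S\<in>Pow U. \<Sum>T\<in>Pow (V - U). if card S = a then 1 else 0)"
  proof (intro sum.cong refl)
    fix S T assume "S \<in> Pow U" "T \<in> Pow (V - U)"
    then have "U \<inter> (S \<union> T) = S" by auto
    then show "(if card (U \<inter> (S \<union> T)) = a then 1 else 0) = (if card S = a then 1 else (0::nat))" by simp
  qed
  also have "\<dots> = 2 ^ card (V - U) * (\<Sum>S\<in>Pow U. if card S = a then 1 else 0)"
    using V by (simp add: card_Pow sum_distrib_left)
  also have "(\<Sum>S\<in>Pow U. if card S = a then 1 else (0::nat)) = card {S. S \<subseteq> U \<and> card S = a}"
    using finU by (simp add: sum.If_cases Int_def Pow_def)
  also have "\<dots> = m choose a" using n_subsets[OF finU] U by simp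
  also have "card (V - U) = card V - m" using U finU by (simp add: card_Diff_subset)
  finally show ?thesis by simp
qed

text \<open>
  For a random block $A$ the coefficients that split as $(a, m-a)$ carry the fraction
  $P = {m \choose a} 2^{-m}$ of level $m$. Jensen's inequality for the power $1 + 1/m$ gives the factor
  $P^{1+1/m}$, and $P^{1/m} \ge 1/2$ because ${m \choose a} \ge 1$.
\<close>
lemma level_norm_le_average_split_norm:
  assumes V: "finite V" and ab: "1 \<le> a" "a < m"
  shows "real (m choose a) / 2 ^ m / 2 * level_norm V c m
         \<le> (\<Sum>A\<in>Pow V. split_norm A (V - A) c a (m - a)) / 2 ^ card V"
proof (cases "m \<le> card V")
  case False
  have none: "{S. S \<subseteq> V \<and> card S = m} = {}"
    using False V card_mono by auto
  have "level_norm V c m = 0" unfolding level_norm_def none by simp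
  then show ?thesis by (auto simp: split_norm_def intro!: divide_nonneg_nonneg sum_nonneg)
next
  case True
  let ?n = "2 ^ card V :: real"
  let ?r = "1 + 1 / real m"
  define w where "w S = ((c S)\<^sup>2) powr (real m / (real m + 1))" for S
  define W where "W = (\<Sum>U | U \<subseteq> V \<and> card U = m. w U)"
  define h where "h A = (\<Sum>S | S \<subseteq> A \<and> card S = a. \<Sum>T | T \<subseteq> V - A \<and> card T = m - a. w (S \<union> T))" for A
  have W0: "0 \<le> W" by (auto simp: W_def w_def intro: sum_nonneg)
  have h0: "0 \<le> h A" for A by (auto simp: h_def w_def intro!: sum_nonneg)
  have hA: "h A = (\<Sum>U | U \<subseteq> V \<and> card U = m. if card (U \<inter> A) = a then w U else 0)" if A: "A \<in> Pow V" for A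
  proof -
    have finA: "finite A" using A V finite_subset by auto
    have "(\<Sum>U | U \<subseteq> V \<and> card U = m. if card (U \<inter> A) = a then w U else 0)
        = (\<Sum>U\<in>Pow V. if card U = m \<and> card (U \<inter> A) = a then w U else 0)"
    proof -
      have "{U. U \<subseteq> V \<and> card U = m} = {U \<in> Pow V. card U = m}" by auto
      then show ?thesis using V by (simp only: sum.inter_filter finite_Pow_iff) (auto intro!: sum.cong)
    qed
    also have "\<dots> = (\<Sum>U\<in>Pow (A \<union> (V - A)). if card U = m \<and> card (U \<inter> A) = a then w U else 0)"
      using A by (simp add: Un_absorb1)
    also have "\<dots> = (\<Sum>S\<in>Pow A. \<Sum>T\<in>Pow (V - A).
          if card (S \<union> T) = m \<and> card ((S \<union> T) \<inter> A) = a then w (S \<union> T) else 0)"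
      using V finA by (intro sum_Pow_union) auto
    also have "\<dots> = (\<Sum>S\<in>Pow A. \<Sum>T\<in>Pow (V - A). if card S = a \<and> card T = m - a then w (S \<union> T) else 0)"
    proof (intro sum.cong refl)
      fix S T assume ST: "S \<in> Pow A" "T \<in> Pow (V - A)"
      then have "(S \<union> T) \<inter> A = S" by auto
      moreover have "card (S \<union> T) = card S + card T"
        using ST finA V finite_subset[of S A] finite_subset[of T V] by (intro card_Un_disjoint) auto
      ultimately have "card (S \<union> T) = m \<and> card ((S \<union> T) \<inter> A) = a \<longleftrightarrow> card S = a \<and> card T = m - a"
        using ab by auto
      then show "(if card (S \<union> T) = m \<and> card ((S \<union> T) \<inter> A) = a then w (S \<union> T) else 0) =
          (if card S = a \<and> card T = m - a then w (S \<union> T) else 0)" by simp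
    qed
    also have "\<dots> = (\<Sum>S\<in>Pow A. if card S = a then (\<Sum>T\<in>Pow (V - A). if card T = m - a then w (S \<union> T) else 0) else 0)"
      by (intro sum.cong refl) auto
    also have "\<dots> = h A"
    proof -
      have e: "{U. U \<subseteq> X \<and> card U = k} = {U \<in> Pow X. card U = k}" for X :: "nat set" and k by auto
      show ?thesis unfolding h_def e using V finA by (simp only: sum.inter_filter finite_Pow_iff finite_Diff)
    qed
    finally show ?thesis by simp
  qed
  have "(\<Sum>A\<in>Pow V. h A) = (\<Sum>A\<in>Pow V. \<Sum>U | U \<subseteq> V \<and> card U = m. if card (U \<inter> A) = a then w U else 0)"
    by (intro sum.cong refl hA)
  also have "\<dots> = (\<Sum>U | U \<subseteq> V \<and> card U = m. \<Sum>A\<in>Pow V. if card (U \<inter> A) = a then w U else 0)"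
    by (rule sum.swap)
  also have "\<dots> = (\<Sum>U | U \<subseteq> V \<and> card U = m. real (m choose a) * 2 ^ (card V - m) * w U)"
  proof (intro sum.cong refl)
    fix U assume U: "U \<in> {U. U \<subseteq> V \<and> card U = m}"
    have "(\<Sum>A\<in>Pow V. if card (U \<inter> A) = a then w U else 0) = real (card {A \<in> Pow V. card (U \<inter> A) = a}) * w U"
      using V by (simp add: sum.If_cases Int_def)
    then show "(\<Sum>A\<in>Pow V. if card (U \<inter> A) = a then w U else 0) = real (m choose a) * 2 ^ (card V - m) * w U"
      using card_subsets_meeting[OF V, of U m a] U by simp
  qed
  also have "\<dots> = real (m choose a) * 2 ^ (card V - m) * W" by (simp add: W_def sum_distrib_left)
  also have "(2::real) ^ (card V - m) = ?n / 2 ^ m" using True by (simp add: power_diff)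
  finally have mean: "(\<Sum>A\<in>Pow V. h A) / ?n = real (m choose a) / 2 ^ m * W" by simp
  let ?P = "real (m choose a) / 2 ^ m"
  have "0 < m choose a" using ab by (intro zero_less_binomial) simp
  then have "1 \<le> real (m choose a)" by linarith
  then have P: "1 / 2 ^ m \<le> ?P" "0 < ?P" using ab by (auto intro!: divide_right_mono divide_pos_pos)
  \<comment> \<open>$P \ge 2^{-m}$, so the extra power $1/m$ costs at most a factor 2\<close>
  have "1 / 2 = (1 / 2 ^ m) powr (1 / real m)"
    using ab by (simp add: powr_divide powr_realpow[symmetric] powr_powr)
  also have "\<dots> \<le> ?P powr (1 / real m)" using P by (intro powr_mono2) auto
  finally have "?P * (1 / 2) \<le> ?P * ?P powr (1 / real m)"
    using P by (intro mult_left_mono) auto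
  also have "\<dots> = ?P powr ?r" using P by (simp add: powr_add)
  finally have "?P / 2 * level_norm V c m \<le> ?P powr ?r * W powr ?r"
    unfolding level_norm_def W_def[symmetric] w_def[symmetric] by (intro mult_right_mono) auto
  also have "\<dots> = ((\<Sum>A\<in>Pow V. h A) / ?n) powr ?r" by (simp only: mean powr_mult)
  also have "\<dots> \<le> (\<Sum>A\<in>Pow V. h A powr ?r) / ?n"
    using powr_mean_le_mean_powr[of ?r "Pow V" h] h0 V by (auto simp: card_Pow)
  also have "(\<Sum>A\<in>Pow V. h A powr ?r) = (\<Sum>A\<in>Pow V. split_norm A (V - A) c a (m - a))"
    using ab by (simp add: split_norm_def h_def w_def)
  finally show ?thesis .
qed

text \<open>
  The induction step: levels at most $N$ control every level $m$ for which a random split into two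
  admissible parts of size at most $N$ has probability at least $Q$.
\<close>
lemma level_norm_sum_step:
  assumes lb: "level_bound M N \<beta>" and mw: "moment_weight M N \<sigma>"
    and V: "finite V"
    and deg: "\<forall>S\<subseteq>V. M < card S \<longrightarrow> c S = 0"
    and bd: "cube_bounded V c u"
    and I: "finite I" and \<kappa>: "0 \<le> \<kappa>" and Q: "0 < Q"
    and good: "\<And>m a. m \<in> I \<Longrightarrow> a \<in> good m \<Longrightarrow>
      a \<in> {1..N} \<and> m - a \<in> {1..N} \<and> balance_cost \<sigma> \<kappa> a (m - a)"
    and many: "\<And>m. m \<in> I \<Longrightarrow> Q * 2 ^ m \<le> (\<Sum>a\<in>good m. real (m choose a))"
  shows "(\<Sum>m\<in>I. level_norm V c m) \<le> 4 * \<kappa> / Q * \<beta> * u\<^sup>2"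
proof -
  let ?n = "2 ^ card V :: real"
  have "Q / 2 * (\<Sum>m\<in>I. level_norm V c m) = (\<Sum>m\<in>I. Q / 2 * level_norm V c m)"
    by (simp add: sum_distrib_left)
  also have "\<dots> \<le> (\<Sum>m\<in>I. \<Sum>a\<in>good m. real (m choose a) / 2 ^ m / 2 * level_norm V c m)"
  proof (intro sum_mono)
    fix m assume m: "m \<in> I"
    have "Q / 2 \<le> (\<Sum>a\<in>good m. real (m choose a)) / 2 ^ m / 2"
      using many[OF m] by (simp add: field_simps)
    then have "Q / 2 * level_norm V c m \<le> (\<Sum>a\<in>good m. real (m choose a)) / 2 ^ m / 2 * level_norm V c m"
      by (intro mult_right_mono) (auto simp: level_norm_def)
    then show "Q / 2 * level_norm V c m \<le> (\<Sum>a\<in>good m. real (m choose a) / 2 ^ m / 2 * level_norm V c m)"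
      by (simp add: sum_distrib_right sum_divide_distrib)
  qed
  also have "\<dots> \<le> (\<Sum>m\<in>I. \<Sum>a\<in>good m. (\<Sum>A\<in>Pow V. split_norm A (V - A) c a (m - a)) / ?n)"
  proof (intro sum_mono level_norm_le_average_split_norm V)
    fix m a assume "m \<in> I" "a \<in> good m"
    from good[OF this] show "1 \<le> a" "a < m" by auto
  qed
  also have "\<dots> = (\<Sum>m\<in>I. \<Sum>A\<in>Pow V. \<Sum>a\<in>good m. split_norm A (V - A) c a (m - a) / ?n)"
    unfolding sum_divide_distrib by (intro sum.cong refl sum.swap)
  also have "\<dots> = (\<Sum>A\<in>Pow V. \<Sum>m\<in>I. \<Sum>a\<in>good m. split_norm A (V - A) c a (m - a) / ?n)"
    by (rule sum.swap)
  also have "\<dots> = (\<Sum>A\<in>Pow V. \<Sum>m\<in>I. \<Sum>a\<in>good m. split_norm A (V - A) c a (m - a)) / ?n"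
    by (simp add: sum_divide_distrib)
  also have "\<dots> \<le> (\<Sum>A\<in>Pow V. 2 * \<kappa> * \<beta> * u\<^sup>2) / ?n"
  proof (intro divide_right_mono sum_mono sum_split_norm_bound[OF lb mw] I \<kappa>)
    fix A assume A: "A \<in> Pow V"
    then have "A \<union> (V - A) = V" by auto
    then show "\<forall>S\<subseteq>A \<union> (V - A). M < card S \<longrightarrow> c S = 0" "cube_bounded (A \<union> (V - A)) c u"
      using deg bd by simp_all
    show "finite A" using A V finite_subset by auto
  qed (use V good in auto)
  also have "\<dots> = 2 * \<kappa> * \<beta> * u\<^sup>2" using V by (simp add: card_Pow)
  finally show ?thesis using Q by (simp add: field_simps)
qed

section \<open>Coefficients of bounded polynomials\<close>

text \<open>
  A polynomial $p$ bounded on $[-1,1]$ is studied through $p(\cos t)$, a cosine sum of the same degree.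
  Its coefficients are integrals and hence bounded, which bounds its derivative at $\pi/2$, and that is
  $-p'(0)$. The resulting bound, quadratic in the degree, is weaker than Bernstein's but sufficient.
\<close>
definition cosine_sum :: "nat \<Rightarrow> (real \<Rightarrow> real) \<Rightarrow> bool" where
  "cosine_sum n f \<longleftrightarrow> (\<exists>b. \<forall>t. f t = (\<Sum>k\<le>n. b k * cos (real k * t)))"

lemma cosine_sum_add:
  assumes "cosine_sum n f" "cosine_sum n g"
  shows "cosine_sum n (\<lambda>t. f t + g t)"
proof -
  obtain b d where "\<forall>t. f t = (\<Sum>k\<le>n. b k * cos (real k * t))" "\<forall>t. g t = (\<Sum>k\<le>n. d k * cos (real k * t))"
    using assms unfolding cosine_sum_def by blast
  then have "\<forall>t. f t + g t = (\<Sum>k\<le>n. (b k + d k) * cos (real k * t))"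
    by (simp add: sum.distrib distrib_right)
  then show ?thesis unfolding cosine_sum_def by (rule exI[of _ "\<lambda>k. b k + d k"])
qed

lemma cosine_sum_scale:
  assumes "cosine_sum n f" shows "cosine_sum n (\<lambda>t. r * f t)"
proof -
  obtain b where "\<forall>t. f t = (\<Sum>k\<le>n. b k * cos (real k * t))"
    using assms unfolding cosine_sum_def by blast
  then have "\<forall>t. r * f t = (\<Sum>k\<le>n. (r * b k) * cos (real k * t))"
    by (simp add: sum_distrib_left mult_ac)
  then show ?thesis unfolding cosine_sum_def by (rule exI[of _ "\<lambda>k. r * b k"])
qed

lemma cosine_sum_cos:
  assumes "j \<le> n" shows "cosine_sum n (\<lambda>t. cos (real j * t))"
proof -
  have "(\<Sum>k\<le>n. (if k = j then 1 else 0) * cos (real k * t)) = (\<Sum>k\<le>n. if k = j then cos (real k * t) else 0)" for t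
    by (intro sum.cong) auto
  then show ?thesis
    unfolding cosine_sum_def using assms by (intro exI[of _ "\<lambda>k. if k = j then 1 else 0"]) simp
qed

lemma cosine_sum_const: "cosine_sum n (\<lambda>t. r)"
  using cosine_sum_scale[OF cosine_sum_cos[of 0 n], of r] by simp

lemma cosine_sum_sum:
  assumes "finite I" "\<And>i. i \<in> I \<Longrightarrow> cosine_sum n (f i)"
  shows "cosine_sum n (\<lambda>t. \<Sum>i\<in>I. f i t)"
  using assms by (induction I rule: finite_induct) (auto intro: cosine_sum_add cosine_sum_const)

lemma cosine_sum_poly_cos:
  assumes "degree p \<le> n" shows "cosine_sum n (\<lambda>t. poly p (cos t))"
  using assms
proof (induction n arbitrary: p)
  case 0
  then obtain a where "p = [:a:]" using degree_eq_zeroE by blast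
  then show ?case by (simp add: cosine_sum_const)
next
  case (Suc n)
  obtain a q where p: "p = pCons a q" by (cases p) auto
  have "degree q \<le> n" using Suc.prems p by (cases "q = 0") auto
  then obtain b where b: "\<forall>t. poly q (cos t) = (\<Sum>k\<le>n. b k * cos (real k * t))"
    using Suc.IH unfolding cosine_sum_def by blast
  have "cosine_sum (Suc n) (\<lambda>t. cos t * cos (real k * t))" if k: "k \<le> n" for k
  proof (cases k)
    case 0
    then show ?thesis using cosine_sum_cos[of 1 "Suc n"] by simp
  next
    case (Suc j)
    have "cos t * cos (real k * t) = 1 / 2 * cos (real (k + 1) * t) + 1 / 2 * cos (real j * t)" for t
    proof -
      have "real (k + 1) * t = real k * t + t" "real j * t = real k * t - t"
        by (simp_all add: Suc algebra_simps)
      then have "cos (real (k + 1) * t) = cos (real k * t) * cos t - sin (real k * t) * sin t"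
        "cos (real j * t) = cos (real k * t) * cos t + sin (real k * t) * sin t"
        by (simp_all only: cos_add cos_diff)
      then show ?thesis by (simp add: field_simps)
    qed
    moreover have "cosine_sum (Suc n) (\<lambda>t. 1 / 2 * cos (real (k + 1) * t) + 1 / 2 * cos (real j * t))"
      using k Suc by (intro cosine_sum_add cosine_sum_scale cosine_sum_cos) auto
    ultimately show ?thesis by simp
  qed
  then have "cosine_sum (Suc n) (\<lambda>t. a + (\<Sum>k\<le>n. b k * (cos t * cos (real k * t))))"
    by (intro cosine_sum_add cosine_sum_const cosine_sum_sum cosine_sum_scale) auto
  moreover have "poly p (cos t) = a + (\<Sum>k\<le>n. b k * (cos t * cos (real k * t)))" for t
    by (simp add: p b sum_distrib_left mult_ac)
  ultimately show ?case by simp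
qed

lemma has_integral_cos_multiple:
  assumes "m \<in> \<int>"
  shows "((\<lambda>t. cos (m * t)) has_integral (if m = 0 then pi else 0)) {0..pi}"
proof (cases "m = 0")
  case True
  then show ?thesis using has_integral_const_real[of "1::real" 0 pi] by simp
next
  case False
  have "((\<lambda>t. cos (m * t)) has_integral (sin (m * pi) / m - sin (m * 0) / m)) {0..pi}"
    using False
    by (intro fundamental_theorem_of_calculus)
       (auto intro!: derivative_eq_intros simp: has_real_derivative_iff_has_vector_derivative[symmetric])
  moreover have "sin (m * pi) = 0"
    using assms by (elim Ints_cases) (simp add: sin_zero_iff_int2)
  ultimately show ?thesis using False by simp
qed

lemma cosine_coefficient_bound:
  assumes f: "\<And>t. f t = (\<Sum>k\<le>n. b k * cos (real k * t))" and B: "\<And>t. \<bar>f t\<bar> \<le> B"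
    and j: "1 \<le> j" "j \<le> n"
  shows "\<bar>b j\<bar> \<le> 2 * B"
proof -
  have term_integral: "((\<lambda>t. b k * cos (real k * t) * cos (real j * t)) has_integral (if k = j then b j * (pi / 2) else 0)) {0..pi}" for k
  proof -
    have 1: "real k - real j \<in> \<int>" "real k + real j \<in> \<int>" by auto
    have 2: "((\<lambda>t. b k / 2 * cos ((real k - real j) * t) + b k / 2 * cos ((real k + real j) * t)) has_integral
       (b k / 2 * (if real k - real j = 0 then pi else 0) + b k / 2 * (if real k + real j = 0 then pi else 0))) {0..pi}"
      by (intro has_integral_add has_integral_mult_right has_integral_cos_multiple 1)
    \<comment> \<open>product to sum formula\<close>
    have 3: "b k / 2 * cos ((real k - real j) * t) + b k / 2 * cos ((real k + real j) * t)
        = b k * cos (real k * t) * cos (real j * t)" for t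
      by (simp add: left_diff_distrib distrib_right cos_diff cos_add algebra_simps)
    \<comment> \<open>$k + j = 0$ does not occur, since $j \ge 1$\<close>
    have 4: "b k / 2 * (if real k - real j = 0 then pi else 0) + b k / 2 * (if real k + real j = 0 then pi else 0)
        = (if k = j then b j * (pi / 2) else 0)" using j by auto
    show ?thesis using 2 unfolding 3 4 .
  qed
  have "((\<lambda>t. \<Sum>k\<le>n. b k * cos (real k * t) * cos (real j * t)) has_integral
      (\<Sum>k\<le>n. if k = j then b j * (pi / 2) else 0)) {0..pi}"
    by (intro has_integral_sum term_integral) auto
  moreover have "(\<Sum>k\<le>n. if k = j then b j * (pi / 2) else 0) = b j * (pi / 2)" using j by simp
  moreover have "(\<Sum>k\<le>n. b k * cos (real k * t) * cos (real j * t)) = f t * cos (real j * t)" for t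
    by (simp add: f sum_distrib_right)
  ultimately have int: "((\<lambda>t. f t * cos (real j * t)) has_integral (b j * (pi / 2))) {0..pi}" by simp
  have B0: "0 \<le> B" using B[of 0] by linarith
  have "norm (b j * (pi / 2)) \<le> B * measure lborel {0..pi}"
  proof (rule has_integral_bound_real[OF B0 finite.emptyI int])
    fix x
    show "norm (f x * cos (real j * x)) \<le> B"
      using B[of x] abs_cos_le_one[of "real j * x"] mult_mono[of "\<bar>f x\<bar>" B "\<bar>cos (real j * x)\<bar>" 1] B0
      by (simp add: abs_mult)
  qed
  then have "\<bar>b j\<bar> * (pi / 2) \<le> (2 * B) * (pi / 2)" by (simp add: abs_mult)
  then show ?thesis by (rule mult_right_le_imp_le) simp
qed

lemma poly_derivative_zero_bound:
  fixes p :: "real poly"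
  assumes deg: "degree p \<le> n" and B: "\<And>x. \<bar>x\<bar> \<le> 1 \<Longrightarrow> \<bar>poly p x\<bar> \<le> B"
  shows "\<bar>poly (pderiv p) 0\<bar> \<le> 2 * real n ^ 2 * B"
proof -
  obtain b where b: "\<And>t. poly p (cos t) = (\<Sum>k\<le>n. b k * cos (real k * t))"
    using cosine_sum_poly_cos[OF deg] unfolding cosine_sum_def by blast
  have bj: "\<bar>b j\<bar> \<le> 2 * B" if "1 \<le> j" "j \<le> n" for j
    using cosine_coefficient_bound[OF b _ that] B abs_cos_le_one by blast
  have B0: "0 \<le> B" using B[of 0] by simp
  have d1: "((\<lambda>t. poly p (cos t)) has_real_derivative poly (pderiv p) (cos (pi/2)) * - sin (pi/2)) (at (pi/2))"
    by (rule DERIV_chain2[OF poly_DERIV]) (auto intro!: derivative_eq_intros)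
  have "((\<lambda>t. \<Sum>k\<le>n. b k * cos (real k * t)) has_real_derivative
       (\<Sum>k\<le>n. b k * (- sin (real k * (pi/2)) * real k))) (at (pi/2))"
    by (auto intro!: derivative_eq_intros sum.cong)
  then have d2: "((\<lambda>t. poly p (cos t)) has_real_derivative
       (\<Sum>k\<le>n. b k * (- sin (real k * (pi/2)) * real k))) (at (pi/2))"
    by (simp only: b)
  have "poly (pderiv p) 0 = - (\<Sum>k\<le>n. b k * (- sin (real k * (pi/2)) * real k))"
    using DERIV_unique[OF d1 d2] by (simp add: sum_negf)
  then have "\<bar>poly (pderiv p) 0\<bar> \<le> (\<Sum>k\<le>n. \<bar>b k * (- sin (real k * (pi/2)) * real k)\<bar>)"
    by (simp only: abs_minus_cancel sum_abs)
  also have "\<dots> \<le> (\<Sum>k\<in>{1..n}. 2 * B * real n)"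
  proof -
    have "(\<Sum>k\<le>n. \<bar>b k * (- sin (real k * (pi/2)) * real k)\<bar>) = (\<Sum>k\<in>{1..n}. \<bar>b k * (- sin (real k * (pi/2)) * real k)\<bar>)"
      by (rule sum.mono_neutral_right) (auto simp: not_le)
    also have "\<dots> \<le> (\<Sum>k\<in>{1..n}. 2 * B * real n)"
    proof (intro sum_mono)
      fix k assume k: "k \<in> {1..n}"
      have "\<bar>b k * (- sin (real k * (pi/2)) * real k)\<bar> = \<bar>b k\<bar> * (\<bar>sin (real k * (pi/2))\<bar> * real k)"
        by (simp add: abs_mult)
      also have "\<dots> \<le> 2 * B * (1 * real n)"
        using k B0 by (intro mult_mono bj abs_sin_le_one) auto
      finally show "\<bar>b k * (- sin (real k * (pi/2)) * real k)\<bar> \<le> 2 * B * real n" by simp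
    qed
    finally show ?thesis .
  qed
  also have "\<dots> = 2 * real n ^ 2 * B" by (simp add: power2_eq_square)
  finally show ?thesis .
qed

lemma poly_derivative_bound:
  fixes p :: "real poly"
  assumes deg: "degree p \<le> n" and r: "0 < r" and B: "\<And>x. \<bar>x - t\<bar> \<le> r \<Longrightarrow> \<bar>poly p x\<bar> \<le> B"
  shows "\<bar>poly (pderiv p) t\<bar> \<le> 2 * real n ^ 2 * B / r"
proof -
  let ?q = "pcompose p [:t, r:]"
  have "degree ?q \<le> n" using deg r by (simp add: degree_pcompose)
  moreover have "\<bar>poly ?q x\<bar> \<le> B" if "\<bar>x\<bar> \<le> 1" for x
    using that r by (simp add: poly_pcompose B abs_mult mult_left_le_one_le)
  ultimately have "\<bar>poly (pderiv ?q) 0\<bar> \<le> 2 * real n ^ 2 * B" by (rule poly_derivative_zero_bound)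
  moreover have "poly (pderiv ?q) 0 = r * poly (pderiv p) t"
    by (simp add: pderiv_pcompose poly_pcompose pderiv_pCons)
  ultimately show ?thesis using r by (simp add: abs_mult field_simps)
qed

text \<open>
  The bound for $p'$ holds on $[-r/2, r/2]$ with room $r/2$ on both sides, so it can be iterated on the
  smaller interval.
\<close>
lemma poly_higher_derivative_zero_bound:
  fixes p :: "real poly"
  assumes "degree p \<le> n" "0 < r" "\<And>x. \<bar>x\<bar> \<le> r \<Longrightarrow> \<bar>poly p x\<bar> \<le> B"
  shows "\<bar>poly ((pderiv ^^ k) p) 0\<bar> \<le> B * (2 ^ (k + 1) * real n ^ 2 / r) ^ k"
  using assms
proof (induction k arbitrary: p r B)
  case 0
  then show ?case by simp
next
  case (Suc k)
  have B0: "0 \<le> B" using Suc.prems(2) Suc.prems(3)[of 0] by simp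
  let ?B = "4 * real n ^ 2 * B / r"
  have p': "\<bar>poly (pderiv p) t\<bar> \<le> ?B" if t: "\<bar>t\<bar> \<le> r / 2" for t
  proof -
    have "\<bar>poly (pderiv p) t\<bar> \<le> 2 * real n ^ 2 * B / (r / 2)"
    proof (intro poly_derivative_bound)
      fix x assume "\<bar>x - t\<bar> \<le> r / 2"
      with t have "\<bar>x\<bar> \<le> r" by linarith
      then show "\<bar>poly p x\<bar> \<le> B" by (rule Suc.prems(3))
    qed (use Suc.prems in auto)
    then show ?thesis by simp
  qed
  have "degree (pderiv p) \<le> n" using Suc.prems(1) by (simp add: degree_pderiv)
  then have "\<bar>poly ((pderiv ^^ k) (pderiv p)) 0\<bar> \<le> ?B * (2 ^ (k + 1) * real n ^ 2 / (r / 2)) ^ k"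
    using Suc.prems(2) p' by (intro Suc.IH) auto
  also have "2 ^ (k + 1) * real n ^ 2 / (r / 2) = 2 ^ (Suc k + 1) * real n ^ 2 / r" by simp
  also have "?B * (2 ^ (Suc k + 1) * real n ^ 2 / r) ^ k
      \<le> (B * (2 ^ (Suc k + 1) * real n ^ 2 / r)) * (2 ^ (Suc k + 1) * real n ^ 2 / r) ^ k"
  proof (intro mult_right_mono)
    have "4 * (B * real n ^ 2) \<le> 2 ^ (Suc k + 1) * (B * real n ^ 2)"
      using B0 one_le_power[of "2::real" k] by (intro mult_right_mono) auto
    then show "?B \<le> B * (2 ^ (Suc k + 1) * real n ^ 2 / r)"
      using Suc.prems(2) by (simp add: field_simps)
  qed (use Suc.prems(2) in auto)
  finally show ?case by (simp add: funpow_Suc_right mult.assoc del: funpow.simps)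
qed

lemma poly_coeff_bound:
  fixes p :: "real poly"
  assumes "degree p \<le> n" "\<And>x. \<bar>x\<bar> \<le> 1 \<Longrightarrow> \<bar>poly p x\<bar> \<le> B"
  shows "\<bar>coeff p k\<bar> \<le> B * (2 ^ (k + 1) * real n ^ 2) ^ k"
proof -
  have "poly ((pderiv ^^ k) p) 0 = pochhammer 1 k * coeff p k"
    by (simp add: poly_0_coeff_0 coeff_higher_pderiv)
  then have "\<bar>poly ((pderiv ^^ k) p) 0\<bar> = fact k * \<bar>coeff p k\<bar>"
    by (simp add: abs_mult flip: pochhammer_fact)
  moreover have "1 * \<bar>coeff p k\<bar> \<le> fact k * \<bar>coeff p k\<bar>"
    by (intro mult_right_mono) auto
  ultimately show ?thesis
    using poly_higher_derivative_zero_bound[of p n 1 B k] assms by simp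
qed

definition level_part :: "nat \<Rightarrow> (nat set \<Rightarrow> real) \<Rightarrow> nat set \<Rightarrow> real" where
  "level_part k c S = (if card S = k then c S else 0)"

text \<open>
  The level $k$ part of $f$ at a vertex $x$ is the coefficient of $\rho^k$ in the polynomial
  $\rho \mapsto f(\rho x)$, which is bounded on $[-1,1]$. The cost, of order $M^{2k}$, is
  affordable for the first few levels only.
\<close>
lemma cube_bounded_level_part:
  assumes V: "finite V" and deg: "\<forall>S\<subseteq>V. M < card S \<longrightarrow> c S = 0" and bd: "cube_bounded V c b"
  shows "cube_bounded V (level_part k c) (b * (2 ^ (k + 1) * real M ^ 2) ^ k)"
  unfolding cube_bounded_def
proof (intro allI impI)
  fix x :: "nat \<Rightarrow> real" assume x: "\<forall>j\<in>V. x j \<in> {-1, 1}"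
  define p where "p = (\<Sum>S\<in>Pow V. monom (c S * walsh S x) (card S))"
  have "degree p \<le> M"
    unfolding p_def
  proof (intro degree_sum_le)
    fix S assume "S \<in> Pow V"
    then show "degree (monom (c S * walsh S x) (card S)) \<le> M"
      using deg degree_monom_le[of "c S * walsh S x" "card S"] by (cases "card S \<le> M") auto
  qed (use V in auto)
  moreover have "\<bar>poly p r\<bar> \<le> b" if r: "\<bar>r\<bar> \<le> 1" for r
  proof -
    have "poly p r = walsh_poly V c (\<lambda>j. r * x j)"
      by (simp add: p_def poly_sum poly_monom walsh_poly_def walsh_def prod.distrib mult_ac)
    moreover have "\<bar>r * x j\<bar> \<le> 1" if "j \<in> V" for j
      using r x that by (auto simp: abs_mult)
    ultimately show ?thesis using cube_bounded_solid[OF V bd, of "\<lambda>j. r * x j"] by simp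
  qed
  ultimately have "\<bar>coeff p k\<bar> \<le> b * (2 ^ (k + 1) * real M ^ 2) ^ k" by (rule poly_coeff_bound)
  moreover have "coeff p k = walsh_poly V (level_part k c) x"
    unfolding p_def walsh_poly_def level_part_def coeff_sum by (intro sum.cong) auto
  ultimately show "\<bar>walsh_poly V (level_part k c) x\<bar> \<le> b * (2 ^ (k + 1) * real M ^ 2) ^ k" by simp
qed

lemma level_norm_level_part: "level_norm V (level_part k c) k = level_norm V c k"
  unfolding level_norm_def level_part_def by (intro arg_cong2[where f = "(powr)"] sum.cong) auto

lemma level_norm_nonneg: "0 \<le> level_norm V c a" by (simp add: level_norm_def)

lemma level_bound_mono: "level_bound M N \<beta> \<Longrightarrow> \<beta> \<le> \<beta>' \<Longrightarrow> level_bound M N \<beta>'"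
  unfolding level_bound_def by (meson mult_right_mono order_trans zero_le_power2)

text \<open>
  The supremum of a linear form over the vertices is the $\ell_1$ norm of its coefficients, and
  $p_1 = 1$.
\<close>
lemma level_one_bound:
  "level_bound M 1 ((4 * real M ^ 2) ^ 2)"
  unfolding level_bound_def
proof (intro allI impI)
  fix V c b assume V: "finite V" and deg: "\<forall>S\<subseteq>V. M < card S \<longrightarrow> c S = 0" and bd: "cube_bounded V c b"
  define x where "x j = (if c {j} < 0 then - 1 else 1 :: real)" for j
  have "\<bar>walsh_poly V (level_part 1 c) x\<bar> \<le> b * (4 * real M ^ 2)"
    using cube_boundedD[OF cube_bounded_level_part[OF V deg bd, of 1], of x] by (simp add: x_def)
  moreover have "walsh_poly V (level_part 1 c) x = (\<Sum>S | S \<subseteq> V \<and> card S = 1. \<bar>c S\<bar>)"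
  proof -
    have e: "{S. S \<subseteq> V \<and> card S = 1} = {S \<in> Pow V. card S = 1}" by auto
    show ?thesis
      unfolding walsh_poly_def e using V
      by (subst sum.inter_filter) (auto simp: level_part_def walsh_def x_def card_1_singleton_iff intro!: sum.cong)
  qed
  ultimately have "(\<Sum>S | S \<subseteq> V \<and> card S = 1. \<bar>c S\<bar>) ^ 2 \<le> (b * (4 * real M ^ 2)) ^ 2"
    by (intro power_mono) (auto intro: sum_nonneg)
  moreover have "level_norm V c 1 = (\<Sum>S | S \<subseteq> V \<and> card S = 1. \<bar>c S\<bar>) ^ 2"
    using square_powr_half[of _ 1] by (simp add: level_norm_def sum_nonneg powr_numeral)
  ultimately show "(\<Sum>a=1..1. level_norm V c a) \<le> (4 * real M ^ 2) ^ 2 * b\<^sup>2"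
    by (simp add: power_mult_distrib mult.commute)
qed

section \<open>The first four levels\<close>

lemma moment_weight_low_degree: "moment_weight d N (\<lambda>_ _. (1 / 9) ^ d)"
  unfolding moment_weight_def
proof (intro conjI allI ballI impI)
  fix a V and c :: "nat set \<Rightarrow> real"
  assume a: "a \<in> {1..N}" and V: "finite V" and deg: "\<forall>S\<subseteq>V. d < card S \<longrightarrow> c S = 0"
  have "1 \<le> 2 * (real a / (real a + 1))" using a by (simp add: field_simps)
  then have "(\<Sum>T\<in>Pow V. (1 / 9) ^ d * (c T)\<^sup>2) powr (2 * (real a / (real a + 1)) / 2)
         \<le> cube_avg V (\<lambda>x. \<bar>walsh_poly V c x\<bar> powr (2 * (real a / (real a + 1))))"
    using V deg by (intro low_degree_moment_comparison) auto
  then show "(\<Sum>T\<in>Pow V. (1 / 9) ^ d * (c T)\<^sup>2) powr (real a / (real a + 1))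
         \<le> cube_avg V (\<lambda>x. \<bar>walsh_poly V c x\<bar> powr (2 * (real a / (real a + 1))))"
    by (simp only: nonzero_mult_div_cancel_left zero_neq_numeral not_False_eq_True)
qed simp

text \<open>
  For bounded degree no constant matters: the moment inequality holds with a constant weight, and each
  $m$ with $N < m \le 2N$ has at least one split into two parts of size at most $N$.
\<close>
lemma level_bound_double_low_degree:
  assumes lb: "level_bound d N \<beta>" and \<beta>: "0 \<le> \<beta>" and N: "1 \<le> N"
  shows "\<exists>\<beta>'\<ge>0. level_bound d (2 * N) \<beta>'"
proof -
  define Q where "Q = (1 / 2 :: real) ^ (2 * N)"
  let ?k = "4 * 9 ^ d / Q * \<beta>"
  have Q: "0 < Q" by (simp add: Q_def)
  have "level_bound d (2 * N) (\<beta> + ?k)"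
    unfolding level_bound_def
  proof (intro allI impI)
    fix V c b assume V: "finite V" and deg: "\<forall>S\<subseteq>V. d < card S \<longrightarrow> c S = 0" and bd: "cube_bounded V c b"
    have "(\<Sum>m\<in>{N+1..2*N}. level_norm V c m) \<le> ?k * b\<^sup>2"
    proof (rule level_norm_sum_step[OF lb moment_weight_low_degree V deg bd, where good = "\<lambda>m. {m - N..N}"])
      fix m a assume "m \<in> {N+1..2*N}" "a \<in> {m - N..N}"
      moreover have "balance_cost (\<lambda>_ _. (1 / 9) ^ d) (9 ^ d) a (m - a)" if "1 \<le> a"
        using that by (simp add: balance_cost_def power_divide flip: powr_add add_divide_distrib)
      ultimately show "a \<in> {1..N} \<and> m - a \<in> {1..N} \<and> balance_cost (\<lambda>_ _. (1 / 9) ^ d) (9 ^ d) a (m - a)"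
        by auto
    next
      fix m assume m: "m \<in> {N+1..2*N}"
      have "Q * 2 ^ m \<le> Q * 2 ^ (2 * N)" using m Q by (intro mult_left_mono power_increasing) auto
      also have "\<dots> = 1" by (simp add: Q_def power_divide)
      also have "1 \<le> real (m choose N)"
      proof -
        have "0 < m choose N" using m by (intro zero_less_binomial) auto
        then show ?thesis by linarith
      qed
      also have "\<dots> \<le> (\<Sum>a\<in>{m - N..N}. real (m choose a))"
        using m by (intro member_le_sum) auto
      finally show "Q * 2 ^ m \<le> (\<Sum>a\<in>{m - N..N}. real (m choose a))" .
    qed (use Q in auto)
    moreover have "(\<Sum>m=1..N. level_norm V c m) \<le> \<beta> * b\<^sup>2"
      using lb V deg bd unfolding level_bound_def by blast
    moreover have "(\<Sum>m=1..2*N. level_norm V c m) = (\<Sum>m=1..N. level_norm V c m) + (\<Sum>m=N+1..2*N. level_norm V c m)"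
      using sum.ub_add_nat[of 1 N "level_norm V c" N] N by (simp add: mult_2)
    ultimately show "(\<Sum>m=1..2*N. level_norm V c m) \<le> (\<beta> + ?k) * b\<^sup>2"
      by (simp add: distrib_right)
  qed
  moreover have "0 \<le> \<beta> + ?k" using \<beta> Q by simp
  ultimately show ?thesis by blast
qed

lemma level_bound_degree_four: "\<exists>\<beta>\<ge>0. level_bound 4 4 \<beta>"
proof -
  have "\<exists>\<beta>\<ge>0. level_bound 4 1 \<beta>" using level_one_bound[of 4] by (intro exI conjI) auto
  then obtain \<beta> where "0 \<le> \<beta>" "level_bound 4 1 \<beta>" by blast
  then obtain \<beta>' where "0 \<le> \<beta>'" "level_bound 4 2 \<beta>'"
    using level_bound_double_low_degree[of 4 1 \<beta>] by auto
  then show ?thesis using level_bound_double_low_degree[of 4 2 \<beta>'] by auto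
qed

text \<open>
  A level $k \le 4$ is extracted as a bounded function of degree at most 4, to which the constant bound
  for degree 4 applies. Extraction costs $(32 M^2)^4$, which enters squared.
\<close>
lemma level_bound_first_four: "\<exists>K\<ge>0. \<forall>M\<ge>1. level_bound M 4 (K * real M ^ 16)"
proof -
  obtain \<beta> where \<beta>: "0 \<le> \<beta>" "level_bound 4 4 \<beta>" using level_bound_degree_four by blast
  have "level_bound M 4 (4 * \<beta> * 32 ^ 8 * real M ^ 16)" if M: "1 \<le> M" for M
    unfolding level_bound_def
  proof (intro allI impI)
    fix V c b assume V: "finite V" and deg: "\<forall>S\<subseteq>V. M < card S \<longrightarrow> c S = 0" and bd: "cube_bounded V c b"
    have b0: "0 \<le> b" using bd by (rule cube_bounded_nonneg)
    have "level_norm V c k \<le> \<beta> * (b * (32 * real M ^ 2) ^ 4)\<^sup>2" if k: "k \<in> {1..4}" for k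
    proof -
      let ?u = "b * (2 ^ (k + 1) * real M ^ 2) ^ k"
      have u: "?u \<le> b * (32 * real M ^ 2) ^ 4"
      proof (intro mult_left_mono b0)
        have "(2::real) ^ (k + 1) \<le> 2 ^ 5" using k by (intro power_increasing) auto
        then have "(2 ^ (k + 1) * real M ^ 2) ^ k \<le> (32 * real M ^ 2) ^ k"
          by (intro power_mono mult_right_mono) auto
        also have "\<dots> \<le> (32 * real M ^ 2) ^ 4"
        proof (intro power_increasing)
          have "1 \<le> real M ^ 2" using M by (intro one_le_power) simp
          then show "1 \<le> 32 * real M ^ 2" by simp
        qed (use k in auto)
        finally show "(2 ^ (k + 1) * real M ^ 2) ^ k \<le> (32 * real M ^ 2) ^ 4" .
      qed
      have "level_norm V c k = level_norm V (level_part k c) k" by (simp add: level_norm_level_part)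
      also have "\<dots> \<le> (\<Sum>a=1..4. level_norm V (level_part k c) a)"
        using k by (intro member_le_sum level_norm_nonneg) auto
      also have "\<dots> \<le> \<beta> * ?u\<^sup>2"
      proof -
        have "\<forall>S\<subseteq>V. 4 < card S \<longrightarrow> level_part k c S = 0" using k by (auto simp: level_part_def)
        then show ?thesis
          using \<beta>(2) V cube_bounded_level_part[OF V deg bd, of k] unfolding level_bound_def by blast
      qed
      also have "\<beta> * ?u\<^sup>2 \<le> \<beta> * (b * (32 * real M ^ 2) ^ 4)\<^sup>2"
        using \<beta> b0 by (intro mult_left_mono power_mono u) auto
      finally show ?thesis .
    qed
    then have "(\<Sum>a=1..4. level_norm V c a) \<le> (\<Sum>a\<in>{1..4::nat}. \<beta> * (b * (32 * real M ^ 2) ^ 4)\<^sup>2)"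
      by (rule sum_mono)
    also have "\<dots> = 4 * \<beta> * 32 ^ 8 * real M ^ 16 * b\<^sup>2"
      by (simp add: power_mult_distrib flip: power_mult)
    finally show "(\<Sum>a=1..4. level_norm V c a) \<le> 4 * \<beta> * 32 ^ 8 * real M ^ 16 * b\<^sup>2" .
  qed
  then show ?thesis using \<beta>(1) by (intro exI[of _ "4 * \<beta> * 32 ^ 8"]) auto
qed

section \<open>From level $3N/4$ to level $N$\<close>

text \<open>
  $(p_a - 1)^b$, with the truncated subtraction keeping the weight nonnegative also at $a = 0$.
\<close>
definition noise_weight :: "nat \<Rightarrow> nat \<Rightarrow> real" where
  "noise_weight a b = (real (a - 1) / real (a + 1)) ^ b"

lemma moment_weight_noise: "moment_weight M N noise_weight"
  unfolding moment_weight_def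
proof (intro conjI allI ballI impI)
  fix a V c assume a: "a \<in> {1..N}" and V: "finite (V :: nat set)" 
  let ?p = "2 * (real a / (real a + 1))"
  have "?p - 1 = real (a - 1) / real (a + 1)" using a by (simp add: of_nat_diff field_simps)
  moreover have "1 \<le> ?p" "?p \<le> 2" using a by (auto simp: field_simps)
  moreover have "?p / 2 = real a / (real a + 1)"
    by (simp only: nonzero_mult_div_cancel_left zero_neq_numeral not_False_eq_True)
  ultimately show "(\<Sum>T\<in>Pow V. noise_weight a (card T) * (c T)\<^sup>2) powr (real a / (real a + 1))
         \<le> cube_avg V (\<lambda>x. \<bar>walsh_poly V c x\<bar> powr ?p)"
    using Bonami_Beckner[of ?p V c] V unfolding noise_weight_def by metis
qed (simp add: noise_weight_def)

text \<open>
  $((a-1)/(a+1))^a$ tends to $e^{-2}$, so for comparable block sizes the noise costs only a constant,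
  however large the degree. At $a = 1$ the weight vanishes, which is why the recursion starts above
  level 4, where balanced parts have size at least 2.
\<close>
lemma noise_weight_diagonal:
  assumes a: "2 \<le> a" shows "1 / 27 \<le> (real (a - 1) / real (a + 1)) ^ a"
proof -
  obtain k where k: "a = Suc k" "1 \<le> k" using a by (cases a) auto
  have k0: "0 < real k" using k by simp
  have ratio: "real (a + 1) / real (a - 1) = 1 + 2 / real k"
    using k k0 by (simp add: field_simps)
  have "(real (a + 1) / real (a - 1)) ^ a = (1 + 2 / real k) ^ k * (1 + 2 / real k)"
    unfolding ratio by (simp only: k power_Suc2)
  also have "\<dots> \<le> 9 * 3"
  proof (intro mult_mono)
    have "(1 + 2 / real k) ^ k \<le> exp (2 / real k) ^ k"
      by (intro power_mono) auto
    also have "\<dots> = exp 1 ^ 2" using k0 by (simp flip: exp_of_nat_mult)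
    also have "\<dots> \<le> (3::real) ^ 2" by (intro power_mono exp_le) auto
    finally show "(1 + 2 / real k) ^ k \<le> 9" by simp
    show "1 + 2 / real k \<le> 3" using k by (simp add: field_simps)
  qed auto
  finally have "(real (a + 1) / real (a - 1)) ^ a \<le> 27" by simp
  moreover have "(real (a - 1) / real (a + 1)) ^ a = 1 / (real (a + 1) / real (a - 1)) ^ a"
    by (simp add: power_divide)
  moreover have "0 < (real (a + 1) / real (a - 1)) ^ a" using a by simp
  ultimately show ?thesis by (simp only:) (intro divide_left_mono, auto)
qed

text \<open>
  The exponents arrange themselves: $((p_a-1)^b)^{a/(a+b)} = ((p_a-1)^a)^{b/(a+b)}$, so the two
  diagonal bounds enter with total weight 1.
\<close>
lemma balance_cost_noise:
  assumes ab: "2 \<le> a" "2 \<le> b" shows "balance_cost noise_weight 27 a b"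
proof -
  have *: "(1 / 27) powr (b / (a + b)) \<le> noise_weight a b powr (a / (a + b))"
    if a: "2 \<le> a" for a b :: nat
  proof -
    let ?t = "real (a - 1) / real (a + 1)"
    have t: "0 < ?t" using a by simp
    have "(1 / 27) powr (b / (a + b)) \<le> (?t ^ a) powr (b / (a + b))"
      using noise_weight_diagonal[OF a] by (intro powr_mono2) auto
    also have "\<dots> = noise_weight a b powr (a / (a + b))"
      using t unfolding noise_weight_def
      by (simp only: powr_realpow[OF t, symmetric] powr_powr) (simp add: mult.commute)
    finally show ?thesis .
  qed
  have one: "real b / real (a + b) + real a / real (a + b) = 1"
    unfolding add_divide_distrib[symmetric] using ab by simp
  have "27 * ((1 / 27) powr (b / (a + b)) * (1 / 27) powr (a / (a + b))) = (1::real)"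
    by (simp only: powr_add[symmetric] one) simp
  moreover have "(1 / 27) powr (b / (a + b)) * (1 / 27) powr (a / (a + b))
      \<le> noise_weight a b powr (a / (a + b)) * noise_weight b a powr (b / (a + b))"
    using *[OF ab(1), of b] *[OF ab(2), of a] by (intro mult_mono) (auto simp: add.commute)
  ultimately show ?thesis unfolding balance_cost_def by linarith
qed

lemma sum_binomial_squared_deviation:
  "(\<Sum>k\<le>m. (2 * real k - real m)\<^sup>2 * real (m choose k)) = real m * 2 ^ m"
proof -
  let ?B = "\<lambda>k. Bernstein m k (1/2)"
  have B: "real (m choose k) = 2 ^ m * ?B k" if "k \<le> m" for k
  proof -
    have "(1/2::real) ^ k * (1/2) ^ (m - k) = (1/2) ^ m" using that by (simp flip: power_add)
    then show ?thesis by (simp add: Bernstein_def mult.assoc power_divide)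
  qed
  have "(\<Sum>k\<le>m. (2 * real k - real m)\<^sup>2 * real (m choose k))
     = 2 ^ m * (\<Sum>k\<le>m. (2 * real k - real m)\<^sup>2 * ?B k)"
    unfolding sum_distrib_left by (intro sum.cong refl) (simp add: B)
  also have "(\<Sum>k\<le>m. (2 * real k - real m)\<^sup>2 * ?B k)
     = (\<Sum>k\<le>m. 4 * (real k * (real k - 1) * ?B k) + (4 - 4 * real m) * (real k * ?B k) + (real m)\<^sup>2 * ?B k)"
    by (intro sum.cong refl) (simp add: power2_eq_square algebra_simps)
  also have "\<dots> = 4 * (real m * (real m - 1) * (1/2)\<^sup>2) + (4 - 4 * real m) * (real m * (1/2)) + (real m)\<^sup>2"
    by (simp add: sum.distrib flip: sum_distrib_left)
  also have "\<dots> = real m" by (simp add: power2_eq_square algebra_simps)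
  finally show ?thesis by (simp add: mult.commute)
qed

text \<open>
  Chebyshev's inequality for the binomial distribution: the variance $m/4$ against the squared
  deviation $(m/4)^2$ leaves probability at most $4/m$ outside the middle half.
\<close>
lemma central_binomial_mass:
  assumes m: "5 \<le> m"
  shows "1 / 5 * 2 ^ m \<le> (\<Sum>k | m \<le> 4 * k \<and> 4 * k \<le> 3 * m. real (m choose k))"
proof -
  let ?G = "{k. m \<le> 4 * k \<and> 4 * k \<le> 3 * m}"
  have G: "?G \<subseteq> {..m}" by auto
  have fin: "finite ?G" by (rule finite_subset[OF G]) simp
  have "real m ^ 2 / 4 * (\<Sum>k\<in>{..m} - ?G. real (m choose k)) = (\<Sum>k\<in>{..m} - ?G. real m ^ 2 / 4 * real (m choose k))"
    by (simp add: sum_distrib_left)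
  also have "\<dots> \<le> (\<Sum>k\<in>{..m} - ?G. (2 * real k - real m)\<^sup>2 * real (m choose k))"
  proof (intro sum_mono mult_right_mono)
    fix k assume "k \<in> {..m} - ?G"
    then have "4 * real k < real m \<or> 3 * real m < 4 * real k" by auto
    then have "\<bar>real m / 2\<bar> \<le> \<bar>2 * real k - real m\<bar>" by linarith
    then have "(real m / 2)\<^sup>2 \<le> (2 * real k - real m)\<^sup>2" by (simp only: abs_le_square_iff)
    then show "real m ^ 2 / 4 \<le> (2 * real k - real m)\<^sup>2" by (simp add: power_divide)
  qed auto
  also have "\<dots> \<le> (\<Sum>k\<le>m. (2 * real k - real m)\<^sup>2 * real (m choose k))"
    by (intro sum_mono2) auto
  also have "\<dots> = real m * 2 ^ m" by (rule sum_binomial_squared_deviation)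
  finally have "real m * (real m * (\<Sum>k\<in>{..m} - ?G. real (m choose k))) \<le> real m * (4 * 2 ^ m)"
    by (simp add: power2_eq_square)
  then have "real m * (\<Sum>k\<in>{..m} - ?G. real (m choose k)) \<le> 4 * 2 ^ m"
    using m by (auto dest: mult_left_le_imp_le)
  moreover have "5 * (\<Sum>k\<in>{..m} - ?G. real (m choose k)) \<le> real m * (\<Sum>k\<in>{..m} - ?G. real (m choose k))"
    using m by (intro mult_right_mono sum_nonneg) auto
  ultimately have "5 * (\<Sum>k\<in>{..m} - ?G. real (m choose k)) \<le> 4 * 2 ^ m" by linarith
  moreover have "(\<Sum>k\<le>m. real (m choose k)) = (\<Sum>k\<in>{..m} - ?G. real (m choose k)) + (\<Sum>k\<in>?G. real (m choose k))"
    using G by (intro sum.subset_diff) auto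
  moreover have "(\<Sum>k\<le>m. real (m choose k)) = 2 ^ m"
    using choose_row_sum[of m] by (metis of_nat_numeral of_nat_power of_nat_sum)
  ultimately show ?thesis by linarith
qed

text \<open>
  A balanced part of $m \le N$ has size at most $3N/4$. The constant is
  $540 = 4 \cdot 27 / (1/5)$ from the cost 27 of the noise and the probability $1/5$.
\<close>
lemma level_bound_recursion:
  assumes base: "level_bound M 4 \<beta>\<^sub>0" and lb: "level_bound M N\<^sub>1 \<beta>" and N: "5 \<le> N" "3 * N < 4 * (N\<^sub>1 + 1)"
  shows "level_bound M N (\<beta>\<^sub>0 + 540 * \<beta>)"
  unfolding level_bound_def
proof (intro allI impI)
  fix V c b assume V: "finite V" and deg: "\<forall>S\<subseteq>V. M < card S \<longrightarrow> c S = 0" and bd: "cube_bounded V c b"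
  have "(\<Sum>m\<in>{5..N}. level_norm V c m) \<le> 4 * 27 / (1 / 5) * \<beta> * b\<^sup>2"
  proof (rule level_norm_sum_step[OF lb moment_weight_noise V deg bd,
        where good = "\<lambda>m. {k. m \<le> 4 * k \<and> 4 * k \<le> 3 * m}"])
    fix m a assume "m \<in> {5..N}" "a \<in> {k. m \<le> 4 * k \<and> 4 * k \<le> 3 * m}"
    then have "2 \<le> a" "a \<le> N\<^sub>1" "2 \<le> m - a" "m - a \<le> N\<^sub>1" using N by auto
    then show "a \<in> {1..N\<^sub>1} \<and> m - a \<in> {1..N\<^sub>1} \<and> balance_cost noise_weight 27 a (m - a)"
      using balance_cost_noise by simp
  qed (use central_binomial_mass in auto)
  moreover have "(\<Sum>m=1..4. level_norm V c m) \<le> \<beta>\<^sub>0 * b\<^sup>2"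
    using base V deg bd unfolding level_bound_def by blast
  moreover have "(\<Sum>m=1..N. level_norm V c m) = (\<Sum>m=1..4. level_norm V c m) + (\<Sum>m=5..N. level_norm V c m)"
    using sum.ub_add_nat[of 1 4 "level_norm V c" "N - 4"] N by simp
  ultimately show "(\<Sum>m=1..N. level_norm V c m) \<le> (\<beta>\<^sub>0 + 540 * \<beta>) * b\<^sup>2"
    by (simp add: distrib_right)
qed

text \<open>
  Each passage from $3N/4$ to $N$ multiplies the bound by 540, and $540 \cdot (3/4)^{24} \le 3/5$ leaves
  room for the additive contribution of the first four levels.
\<close>
lemma level_bound_polynomial:
  assumes base: "level_bound M 4 \<beta>" and \<beta>: "0 \<le> \<beta>"
  shows "1 \<le> N \<Longrightarrow> level_bound M N (\<beta> * real N ^ 24)"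
proof (induction N rule: less_induct)
  case (less N)
  show ?case
  proof (cases "N \<le> 4")
    case True
    have "level_bound M N \<beta>"
      unfolding level_bound_def
    proof (intro allI impI)
      fix V c b assume V: "finite V" and deg: "\<forall>S\<subseteq>V. M < card S \<longrightarrow> c S = 0" and bd: "cube_bounded V c b"
      have "(\<Sum>m=1..N. level_norm V c m) \<le> (\<Sum>m=1..4. level_norm V c m)"
        using True by (intro sum_mono2 level_norm_nonneg) auto
      also have "\<dots> \<le> \<beta> * b\<^sup>2" using base V deg bd unfolding level_bound_def by blast
      finally show "(\<Sum>m=1..N. level_norm V c m) \<le> \<beta> * b\<^sup>2" .
    qed
    moreover have "1 \<le> real N ^ 24" using less.prems by (intro one_le_power) simp
    then have "\<beta> * 1 \<le> \<beta> * real N ^ 24" using \<beta> by (intro mult_left_mono)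
    ultimately show ?thesis using level_bound_mono by auto
  next
    case False
    define N1 where "N1 = 3 * N div 4"
    have N1: "3 * N < 4 * (N1 + 1)" "4 * N1 \<le> 3 * N"
      unfolding N1_def by presburger+
    then have N1': "1 \<le> N1" "N1 < N" using False by auto
    have "level_bound M N1 (\<beta> * real N1 ^ 24)" using N1' by (intro less.IH) auto
    then have "level_bound M N (\<beta> + 540 * (\<beta> * real N1 ^ 24))"
      using False N1 by (intro level_bound_recursion base) auto
    moreover have "\<beta> + 540 * (\<beta> * real N1 ^ 24) \<le> \<beta> * real N ^ 24"
    proof -
      have "real N1 ^ 24 \<le> (3 / 4 * real N) ^ 24" using N1 by (intro power_mono) auto
      also have "\<dots> = (3 / 4) ^ 24 * real N ^ 24" by (simp only: power_mult_distrib)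
      finally have "540 * real N1 ^ 24 \<le> 540 * (3 / 4) ^ 24 * real N ^ 24" by simp
      also have "\<dots> \<le> 3 / 5 * real N ^ 24" by (intro mult_right_mono) (simp_all add: power_divide)
      finally have 1: "540 * real N1 ^ 24 \<le> 3 / 5 * real N ^ 24" .
      have "(5::real) ^ 1 \<le> 5 ^ 24" by (intro power_increasing) auto
      also have "\<dots> \<le> real N ^ 24" using False by (intro power_mono) auto
      finally have "1 + 540 * real N1 ^ 24 \<le> real N ^ 24" using 1 by simp
      then have "\<beta> * (1 + 540 * real N1 ^ 24) \<le> \<beta> * real N ^ 24" using \<beta> by (intro mult_left_mono)
      then show ?thesis by (simp add: algebra_simps)
    qed
    ultimately show ?thesis by (rule level_bound_mono)
  qed
qed

lemma level_bound_all: "\<exists>K\<ge>0. \<forall>M\<ge>1. level_bound M M (K * real M ^ 40)"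
proof -
  obtain K where K: "0 \<le> K" "\<forall>M\<ge>1. level_bound M 4 (K * real M ^ 16)"
    using level_bound_first_four by blast
  have "level_bound M M (K * real M ^ 40)" if "1 \<le> M" for M
  proof -
    have "level_bound M M (K * real M ^ 16 * real M ^ 24)"
      using K that by (intro level_bound_polynomial) auto
    then show ?thesis by (simp add: mult.assoc flip: power_add)
  qed
  then show ?thesis using K by blast
qed

section \<open>Functions on the cube\<close>

lemma sum_powr_le_powr_sum:
  fixes y :: "'a \<Rightarrow> real"
  assumes t: "1 \<le> t" and I: "finite I" and y: "\<And>i. i \<in> I \<Longrightarrow> 0 \<le> y i"
  shows "(\<Sum>i\<in>I. y i powr t) \<le> (\<Sum>i\<in>I. y i) powr t"
proof -
  let ?Y = "\<Sum>i\<in>I. y i"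
  have split: "z powr t = z * z powr (t - 1)" if "0 \<le> z" for z :: real
    using that t by (cases "z = 0") (auto simp: powr_diff)
  have "(\<Sum>i\<in>I. y i powr t) = (\<Sum>i\<in>I. y i * y i powr (t - 1))"
    using y by (intro sum.cong refl split) auto
  also have "\<dots> \<le> (\<Sum>i\<in>I. y i * ?Y powr (t - 1))"
    using t I y by (intro sum_mono mult_left_mono powr_mono2 member_le_sum) auto
  also have "\<dots> = ?Y * ?Y powr (t - 1)" by (simp add: sum_distrib_right)
  also have "\<dots> = ?Y powr t" using y by (intro split[symmetric] sum_nonneg) auto
  finally show ?thesis .
qed

text \<open>
  All levels are measured with the single exponent $p_M \ge p_m$, which does not increase their
  norms; adding up the $M + 1$ levels crudely costs a factor of order $M$.
\<close>
lemma coefficient_sum_bound: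
  assumes M: "1 \<le> M" and lb: "level_bound M M \<beta>" and \<beta>: "0 \<le> \<beta>" and V: "finite V"
    and deg: "\<forall>S\<subseteq>V. M < card S \<longrightarrow> c S = 0" and bd: "cube_bounded V c b"
  shows "(\<Sum>S | S \<subseteq> V \<and> card S \<le> M. ((c S)\<^sup>2) powr (real M / (real M + 1)))
         \<le> real (M + 1) * ((\<beta> + 1) * b\<^sup>2) powr (real M / (real M + 1))"
proof -
  let ?s = "real M / (real M + 1)"
  let ?L = "(\<beta> + 1) * b\<^sup>2"
  have s: "0 < ?s" using M by simp
  have level: "(\<Sum>S | S \<subseteq> V \<and> card S = m. ((c S)\<^sup>2) powr ?s) \<le> ?L powr ?s" if m: "m \<le> M" for m
  proof (cases "m = 0")
    case True
    have card0: "card S = 0 \<longleftrightarrow> S = {}" if "S \<subseteq> V" for S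
      using finite_subset[OF that V] by simp
    have "{S. S \<subseteq> V \<and> card S = 0} = {{}}" using card0 by auto
    moreover have "(c {})\<^sup>2 \<le> ?L"
    proof -
      \<comment> \<open>the constant coefficient is the value at the centre of the solid cube\<close>
      have "walsh_poly V c (\<lambda>_. 0) = (\<Sum>S\<in>{{}}. c S * walsh S (\<lambda>_. 0))"
        unfolding walsh_poly_def using V card0
        by (intro sum.mono_neutral_right) (auto simp: walsh_def)
      then have "\<bar>c {}\<bar> \<le> b"
        using cube_bounded_solid[OF V bd, of "\<lambda>_. 0"] by (simp add: walsh_def)
      then have "(c {})\<^sup>2 \<le> 1 * b\<^sup>2" using power_mono[of "\<bar>c {}\<bar>" b 2] by simp
      also have "\<dots> \<le> ?L" using \<beta> by (intro mult_right_mono) auto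
      finally show ?thesis .
    qed
    ultimately show ?thesis using True s by (simp add: powr_mono2)
  next
    case False
    then have m1: "1 \<le> m" by simp
    let ?q = "real m / (real m + 1)"
    have q: "0 < ?q" using m1 by simp
    have qs: "?q \<le> ?s" using m by (simp add: field_simps)
    have "\<exists>t\<ge>1. q * t = s" if "0 < q" "q \<le> s" for q s :: real
      using that by (intro exI[of _ "s / q"]) simp
    then obtain t where t: "1 \<le> t" "?q * t = ?s" using q qs by blast
    have "(\<Sum>S | S \<subseteq> V \<and> card S = m. ((c S)\<^sup>2) powr ?s)
        = (\<Sum>S | S \<subseteq> V \<and> card S = m. (((c S)\<^sup>2) powr ?q) powr t)"
      by (simp only: powr_powr t)
    also have "\<dots> \<le> (\<Sum>S | S \<subseteq> V \<and> card S = m. ((c S)\<^sup>2) powr ?q) powr t"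
      using V t by (intro sum_powr_le_powr_sum) auto
    also have "\<dots> = level_norm V c m powr ?s"
    proof -
      have "(1 + 1 / real m) * ?s = t"
        using level_exponents(3)[OF m1] t(2) by (simp only: mult.assoc[symmetric] mult_1 flip: t(2))
      then show ?thesis by (simp only: level_norm_def powr_powr)
    qed
    also have "\<dots> \<le> ?L powr ?s"
    proof (intro powr_mono2 level_norm_nonneg)
      have "level_norm V c m \<le> (\<Sum>a=1..M. level_norm V c a)"
        using m m1 by (intro member_le_sum level_norm_nonneg) auto
      also have "\<dots> \<le> \<beta> * b\<^sup>2" using lb V deg bd unfolding level_bound_def by blast
      also have "\<dots> \<le> ?L" by (simp add: distrib_right)
      finally show "level_norm V c m \<le> ?L" .
    qed (use s in auto)
    finally show ?thesis .
  qed
  have "{S. S \<subseteq> V \<and> card S \<le> M} = (\<Union>m\<in>{..M}. {S. S \<subseteq> V \<and> card S = m})" by auto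
  then have "(\<Sum>S | S \<subseteq> V \<and> card S \<le> M. ((c S)\<^sup>2) powr ?s)
      = (\<Sum>m\<le>M. \<Sum>S | S \<subseteq> V \<and> card S = m. ((c S)\<^sup>2) powr ?s)"
    using V by (simp only:) (intro sum.UNION_disjoint, auto)
  also have "\<dots> \<le> (\<Sum>m\<le>M. ?L powr ?s)" by (intro sum_mono level) auto
  finally show ?thesis by simp
qed

lemma finite_cube: "finite (cube n)" unfolding cube_def by (intro finite_PiE) auto

lemma card_cube: "card (cube n) = 2 ^ n"
  unfolding cube_def by (simp add: card_PiE numeral_2_eq_2)

lemma cube_nonempty: "cube n \<noteq> {}"
  using card_cube[of n] by (metis card.empty power_not_zero zero_neq_numeral)

lemma fourier_coeff_eq:
  "fourier_coeff n f S = (\<Sum>x\<in>cube n. f x * complex_of_real (walsh S x)) / 2 ^ n"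
proof -
  have "fourier_coeff n f S = (\<Sum>x\<in>cube n. pmf (pmf_of_set (cube n)) x *\<^sub>R (f x * complex_of_real (walsh S x)))"
    unfolding fourier_coeff_def
    by (rule integral_measure_pmf) (use finite_cube cube_nonempty in \<open>auto simp: set_pmf_of_set\<close>)
  also have "\<dots> = (\<Sum>x\<in>cube n. f x * complex_of_real (walsh S x) / 2 ^ n)"
    using finite_cube cube_nonempty by (intro sum.cong refl) (simp add: card_cube scaleR_conv_of_real)
  finally show ?thesis by (simp add: sum_divide_distrib)
qed

lemma walsh_orthogonality:
  assumes x: "x \<in> cube n" and y: "y \<in> cube n"
  shows "(\<Sum>S\<in>Pow {1..n}. walsh S y * walsh S x) = (if y = x then 2 ^ n else 0)"
proof -
  have "(\<Sum>S\<in>Pow {1..n}. walsh S y * walsh S x) = (\<Prod>j\<in>{1..n}. y j * x j + 1)"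
    by (subst prod_add) (auto simp: walsh_def prod.distrib)
  also have "\<dots> = (if y = x then 2 ^ n else 0)"
  proof (cases "y = x")
    case True
    have "x j * x j + 1 = 2" if "j \<in> {1..n}" for j
      using x that unfolding cube_def by (auto dest: PiE_mem)
    then show ?thesis using True by simp
  next
    case False
    have "\<exists>j\<in>{1..n}. y j \<noteq> x j"
    proof (rule ccontr)
      assume "\<not> (\<exists>j\<in>{1..n}. y j \<noteq> x j)"
      then have "y = x" using x y unfolding cube_def by (intro PiE_ext) auto
      with False show False ..
    qed
    then obtain j where j: "j \<in> {1..n}" "y j \<noteq> x j" by blast
    have "x j \<in> {-1, 1}" "y j \<in> {-1, 1}" 
      using PiE_mem[OF x[unfolded cube_def] j(1)] PiE_mem[OF y[unfolded cube_def] j(1)] .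
    then have "y j * x j + 1 = 0" using j by auto
    then show ?thesis using False j by (auto intro!: prod_zero)
  qed
  finally show ?thesis .
qed

lemma fourier_inversion:
  assumes x: "x \<in> cube n"
  shows "f x = (\<Sum>S\<in>Pow {1..n}. fourier_coeff n f S * complex_of_real (walsh S x))"
proof -
  have "(\<Sum>S\<in>Pow {1..n}. fourier_coeff n f S * complex_of_real (walsh S x))
     = (\<Sum>S\<in>Pow {1..n}. \<Sum>y\<in>cube n. f y * complex_of_real (walsh S y * walsh S x) / 2 ^ n)"
    by (simp add: fourier_coeff_eq sum_distrib_right sum_divide_distrib mult.assoc)
  also have "\<dots> = (\<Sum>y\<in>cube n. \<Sum>S\<in>Pow {1..n}. f y * complex_of_real (walsh S y * walsh S x) / 2 ^ n)"
    by (rule sum.swap)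
  also have "\<dots> = (\<Sum>y\<in>cube n. f y * complex_of_real (\<Sum>S\<in>Pow {1..n}. walsh S y * walsh S x) / 2 ^ n)"
    by (simp only: of_real_sum sum_distrib_left sum_divide_distrib)
  also have "\<dots> = (\<Sum>y\<in>cube n. if y = x then f y else 0)"
  proof (intro sum.cong refl)
    fix y assume y: "y \<in> cube n"
    show "f y * complex_of_real (\<Sum>S\<in>Pow {1..n}. walsh S y * walsh S x) / 2 ^ n = (if y = x then f y else 0)"
      by (subst walsh_orthogonality[OF x y]) simp
  qed
  also have "\<dots> = f x" using x finite_cube by simp
  finally show ?thesis by simp
qed

lemma cmod_le_cube_sup_norm: "x \<in> cube n \<Longrightarrow> cmod (f x) \<le> cube_sup_norm n f"
  unfolding cube_sup_norm_def using finite_cube by (intro Max_ge) auto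

lemma
  shows cube_bounded_Re_fourier: "cube_bounded {1..n} (\<lambda>S. Re (fourier_coeff n f S)) (cube_sup_norm n f)"
    and cube_bounded_Im_fourier: "cube_bounded {1..n} (\<lambda>S. Im (fourier_coeff n f S)) (cube_sup_norm n f)"
proof -
  have "\<bar>walsh_poly {1..n} (\<lambda>S. Re (fourier_coeff n f S)) x\<bar> \<le> cube_sup_norm n f
      \<and> \<bar>walsh_poly {1..n} (\<lambda>S. Im (fourier_coeff n f S)) x\<bar> \<le> cube_sup_norm n f"
    if x: "\<forall>j\<in>{1..n}. x j \<in> {-1, 1}" for x
  proof -
    let ?z = "restrict x {1..n}"
    have z: "?z \<in> cube n" using x by (auto simp: cube_def)
    have eq: "walsh_poly {1..n} c x = walsh_poly {1..n} c ?z" for c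
      by (intro walsh_poly_cong) auto
    have "walsh_poly {1..n} (\<lambda>S. Re (fourier_coeff n f S)) x = Re (f ?z)"
      unfolding eq fourier_inversion[OF z, of f] by (simp add: walsh_poly_def)
    moreover have "walsh_poly {1..n} (\<lambda>S. Im (fourier_coeff n f S)) x = Im (f ?z)"
      unfolding eq fourier_inversion[OF z, of f] by (simp add: walsh_poly_def)
    ultimately show ?thesis
      using abs_Re_le_cmod[of "f ?z"] abs_Im_le_cmod[of "f ?z"] cmod_le_cube_sup_norm[OF z, of f] by linarith
  qed
  then show "cube_bounded {1..n} (\<lambda>S. Re (fourier_coeff n f S)) (cube_sup_norm n f)"
    "cube_bounded {1..n} (\<lambda>S. Im (fourier_coeff n f S)) (cube_sup_norm n f)"
    unfolding cube_bounded_def by blast+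
qed

text \<open>
  Real and imaginary parts are treated separately, at the cost of a constant.
\<close>
lemma cmod_powr_le:
  assumes s: "0 \<le> s" "s \<le> 1"
  shows "cmod z powr (2 * s) \<le> 2 * (((Re z)\<^sup>2) powr s + ((Im z)\<^sup>2) powr s)"
proof -
  let ?a = "(Re z)\<^sup>2" and ?b = "(Im z)\<^sup>2"
  have "cmod z powr (2 * s) = ((cmod z)\<^sup>2) powr s"
    using square_powr_half[of "cmod z" "2 * s"] by simp
  also have "\<dots> \<le> (2 * max ?a ?b) powr s"
    using s by (intro powr_mono2) (auto simp: cmod_power2)
  also have "\<dots> = 2 powr s * max ?a ?b powr s" by (rule powr_mult)
  also have "\<dots> \<le> 2 powr 1 * (?a powr s + ?b powr s)"
    using s by (intro mult_mono powr_mono) (auto simp: max_def)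
  finally show ?thesis by simp
qed

text \<open>
  The exponent 21 collects $M^{20}$ from the square root of the bound for the levels, where 8 comes from
  the first four levels and 12 from the recursion, and one factor $M$ from adding up the levels.
\<close>
lemma bh_norm_bound:
  assumes M: "1 \<le> M" and K: "0 \<le> K" and lb: "level_bound M M (K * real M ^ 40)"
    and deg: "degree_at_most n M f"
  shows "bh_norm n M f \<le> 8 * sqrt (K + 1) * real M ^ 21 * cube_sup_norm n f"
proof -
  let ?V = "{1..n}" and ?c = "fourier_coeff n f" and ?b = "cube_sup_norm n f"
  let ?s = "real M / (real M + 1)" and ?\<beta> = "K * real M ^ 40"
  define L where "L = (?\<beta> + 1) * ?b\<^sup>2"
  have s: "0 < ?s" "?s \<le> 1" using M by auto
  have b0: "0 \<le> ?b" using cube_bounded_Re_fourier by (rule cube_bounded_nonneg)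
  have deg': "\<forall>S\<subseteq>?V. M < card S \<longrightarrow> ?c S = 0" using deg by (simp add: degree_at_most_def)
  have "(\<Sum>S | S \<subseteq> ?V \<and> card S \<le> M. cmod (?c S) powr (2 * ?s))
     \<le> (\<Sum>S | S \<subseteq> ?V \<and> card S \<le> M. 2 * (((Re (?c S))\<^sup>2) powr ?s + ((Im (?c S))\<^sup>2) powr ?s))"
    using s by (intro sum_mono cmod_powr_le) auto
  also have "\<dots> = 2 * ((\<Sum>S | S \<subseteq> ?V \<and> card S \<le> M. ((Re (?c S))\<^sup>2) powr ?s)
                 + (\<Sum>S | S \<subseteq> ?V \<and> card S \<le> M. ((Im (?c S))\<^sup>2) powr ?s))"
    by (simp only: sum.distrib flip: sum_distrib_left)
  also have "\<dots> \<le> 2 * (real (M + 1) * L powr ?s + real (M + 1) * L powr ?s)"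
    unfolding L_def using K deg' M
    by (intro mult_left_mono add_mono coefficient_sum_bound[OF M lb]
          cube_bounded_Re_fourier cube_bounded_Im_fourier) auto
  also have "\<dots> = 4 * real (M + 1) * L powr ?s" by simp
  finally have sum: "(\<Sum>S | S \<subseteq> ?V \<and> card S \<le> M. cmod (?c S) powr (2 * ?s)) \<le> 4 * real (M + 1) * L powr ?s" .
  let ?e = "(real M + 1) / (2 * real M)"
  have "bh_norm n M f = (\<Sum>S | S \<subseteq> ?V \<and> card S \<le> M. cmod (?c S) powr (2 * ?s)) powr ?e"
    by (simp add: bh_norm_def)
  also have "\<dots> \<le> (4 * real (M + 1) * L powr ?s) powr ?e"
    by (intro powr_mono2 sum sum_nonneg) auto
  also have "\<dots> = (4 * real (M + 1)) powr ?e * (L powr ?s) powr ?e" by (rule powr_mult)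
  also have "(L powr ?s) powr ?e = L powr (1 / 2)"
    using M by (simp add: powr_powr)
  also have "L powr (1 / 2) = sqrt L" using K by (simp add: powr_half_sqrt L_def)
  also have "(4 * real (M + 1)) powr ?e * sqrt L \<le> (8 * real M) * (sqrt (K + 1) * real M ^ 20 * ?b)"
  proof (intro mult_mono)
    have "(4 * real (M + 1)) powr ?e \<le> (4 * real (M + 1)) powr 1"
      using M by (intro powr_mono) (auto simp: field_simps)
    also have "\<dots> \<le> 8 * real M" using M by simp
    finally show "(4 * real (M + 1)) powr ?e \<le> 8 * real M" .
    have "1 \<le> real M ^ 40" using M by (intro one_le_power) simp
    then have "L \<le> ((K + 1) * real M ^ 40) * ?b\<^sup>2"
      unfolding L_def by (intro mult_right_mono) (auto simp: distrib_right)
    also have "\<dots> = (sqrt (K + 1) * real M ^ 20 * ?b)\<^sup>2"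
      using K by (simp add: power_mult_distrib flip: power_mult)
    finally show "sqrt L \<le> sqrt (K + 1) * real M ^ 20 * ?b"
      using K b0 by (intro real_le_lsqrt) auto
  qed (use K b0 in \<open>auto simp: L_def\<close>)
  also have "\<dots> = 8 * sqrt (K + 1) * (real M * real M ^ 20) * ?b" by simp
  also have "real M * real M ^ 20 = real M ^ 21" by (simp flip: power_Suc)
  finally show ?thesis .
qed

theorem theorem1p1:
  shows "\<exists>K::real.
    (\<forall>m n. \<forall>f :: (nat \<Rightarrow> real) \<Rightarrow> complex.
       1 \<le> m \<and> m \<le> n \<and> degree_at_most n m f \<longrightarrow>
       bh_norm n m f \<le> K * real m ^ 27 * cube_sup_norm n f) \<and>
    (\<forall>m\<ge>1. bh_const m \<le> ereal (K * real m ^ 27))"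
proof -
  obtain K where K: "0 \<le> K" "\<forall>M\<ge>1. level_bound M M (K * real M ^ 40)"
    using level_bound_all by blast
  let ?K = "8 * sqrt (K + 1)"
  have main: "bh_norm n m f \<le> ?K * real m ^ 27 * cube_sup_norm n f"
    if m: "1 \<le> m" and deg: "degree_at_most n m f" for m n f
  proof -
    have b0: "0 \<le> cube_sup_norm n f" using cube_bounded_Re_fourier by (rule cube_bounded_nonneg)
    have "bh_norm n m f \<le> ?K * real m ^ 21 * cube_sup_norm n f"
      using bh_norm_bound[OF m K(1) _ deg] K(2) m by blast
    also have "\<dots> \<le> ?K * real m ^ 27 * cube_sup_norm n f"
      using m K(1) b0 by (intro mult_right_mono mult_left_mono power_increasing) auto
    finally show ?thesis .
  qed
  moreover have "bh_const m \<le> ereal (?K * real m ^ 27)" if "1 \<le> m" for m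
    unfolding bh_const_def using main[OF that] by (intro Inf_lower) blast
  ultimately show ?thesis by blast
qed

end
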